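(* Let $\sigma\ge 1$ be a real number, $n\ge 1$, $\gamma\ge 0$, and let $u_0,u_1\in L^{1,\gamma}(\mathbb{R}^n)\cap L^2(\mathbb{R}^n)$. Put $v_0:=u_0+u_1$. Take $k\in\mathbb{N}_0$ satisfying $\lambda(k)\le \gamma<\lambda(k+1)$. Let $u$ be the solution, given by its Fourier representation $\hat u(t,\xi)$, of the linear problem $u_{tt}+(-\Delta)^\sigma u+u_t+(-\Delta)^\sigma u_t=0$, $u(0,x)=u_0(x)$, $u_t(0,x)=u_1(x)$. Then $$\big\|\hat u(t,\xi)-A_k^{\sigma,v_0}(\xi)e^{-t|\xi|^{2\sigma}}\big\|_{L^2}\lesssim t^{-\frac{n}{4\sigma}-\frac{\gamma}{2\sigma}}\big(\|v_0\|_{L^{1,\gamma}}+\|u_0\|_{L^1\cap L^2}+\|u_1\|_{L^1\cap L^2}\big),\qquad t\ge 1.$$ Furthermore, $$\lim_{t\to\infty}t^{\frac{n}{4\sigma}+\frac{\gamma}{2\sigma}}\big\|\hat u(t,\xi)-A_k^{\sigma,v_0}(\xi)e^{-t|\xi|^{2\sigma}}\big\|_{L^2}=0.$$ (The $L^2$ norms are taken in $\xi\in\mathbb{R}^n$.)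
   Context: Notation. $\mathbb{N}_0=\{0,1,2,\dots\}$. $f\lesssim g$ means $f\le Cg$ with a constant $C>0$ (here independent of $t$ and of the data). The Fourier transform is $\hat f(\xi)=\int_{\mathbb{R}^n}e^{-ix\cdot\xi}f(x)\,dx$. For $\gamma\ge 0$, $L^{1,\gamma}(\mathbb{R}^n)$ is the space of $f\in L^1(\mathbb{R}^n)$ with $\|f\|_{L^{1,\gamma}}:=\int_{\mathbb{R}^n}(1+|x|)^\gamma|f(x)|\,dx<\infty$ (so $L^{1,0}=L^1$). The norm of an intersection of spaces is the sum of the norms. $[s]$ is the integer part of $s$. Solution formula. The solution $u$ is the function whose spatial Fourier transform is $$\hat u(t,\xi)=\frac{e^{-t|\xi|^{2\sigma}}-|\xi|^{2\sigma}e^{-t}}{1-|\xi|^{2\sigma}}\widehat{u_0}(\xi)+\frac{e^{-t|\xi|^{2\sigma}}-e^{-t}}{1-|\xi|^{2\sigma}}\widehat{u_1}(\xi)$$ for $|\xi|\ne 1$, extended continuously across $|\xi|=1$; equivalently, for all $\xi$, $$\hat u(t,\xi)=e^{-t}\widehat{u_0}(\xi)+\Big(e^{-t}\int_0^t e^{-s(|\xi|^{2\sigma}-1)}\,ds\Big)\big(\widehat{u_0}(\xi)+\widehat{u_1}(\xi)\big).$$ The sequence $\lambda(k)$. Let $\mathfrak{S}:=\{2\sigma\ell+j:\ \ell,j\in\mathbb{N}_0\}$, $\lambda(0):=\min\mathfrak{S}=0$, and $\lambda(k):=\min\big(\mathfrak{S}\setminus\{\lambda(j):0\le j\le k-1\}\big)$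 for $k\ge 1$; i.e. $\lambda$ enumerates $\mathfrak{S}$ in increasing order. Moments and profile. For $f\in L^{1,\gamma}(\mathbb{R}^n)$ and multi-indices $|\alpha|\le[\gamma]$, $M_\alpha(f):=\frac{(-1)^{|\alpha|}}{\alpha!}\int_{\mathbb{R}^n}x^\alpha f(x)\,dx$. For $v_0\in L^{1,\gamma}(\mathbb{R}^n)$ with $\gamma\ge\lambda(k)$, $$A_k^{\sigma,v_0}(\xi):=\sum_{0\le 2\sigma\ell+j\le\lambda(k)}\Big(|\xi|^{2\sigma\ell}\sum_{|\alpha|=j}M_\alpha(v_0)(i\xi)^\alpha\Big),$$ the outer sum being over all $(\ell,j)\in\mathbb{N}_0^2$ with $0\le 2\sigma\ell+j\le\lambda(k)$. *)

theory Defs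
  imports "HOL-Analysis.Analysis"
begin

text \<open>Function spaces on \<open>\<real>\<^sup>n\<close> (the type \<open>real ^ 'n\<close>, \<open>n = CARD('n)\<close>), for complex-valued
  Lebesgue-measurable functions. The norms are Bochner integrals and hence meaningful only on the
  corresponding spaces, since the integral of a non-integrable function is \<open>0\<close>.\<close>

definition wL1 :: "real \<Rightarrow> (real ^ 'n \<Rightarrow> complex) set" where
  "wL1 \<gamma> = {f. integrable lebesgue f \<and>
                integrable lebesgue (\<lambda>x. (1 + norm x) powr \<gamma> * norm (f x))}"

definition wL1_norm :: "real \<Rightarrow> (real ^ 'n \<Rightarrow> complex) \<Rightarrow> real" where
  "wL1_norm \<gamma> f = (LINT x|lebesgue. (1 + norm x) powr \<gamma> * norm (f x))"

definition L1_norm :: "(real ^ 'n \<Rightarrow> complex) \<Rightarrow> real" where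
  "L1_norm f = (LINT x|lebesgue. norm (f x))"

definition L2 :: "(real ^ 'n \<Rightarrow> complex) set" where
  "L2 = {f. f \<in> borel_measurable lebesgue \<and> integrable lebesgue (\<lambda>x. (norm (f x))\<^sup>2)}"

definition L2_norm :: "(real ^ 'n \<Rightarrow> complex) \<Rightarrow> real" where
  "L2_norm f = sqrt (LINT x|lebesgue. (norm (f x))\<^sup>2)"

definition L1L2_norm :: "(real ^ 'n \<Rightarrow> complex) \<Rightarrow> real" where
  "L1L2_norm f = L1_norm f + L2_norm f"

definition fourier :: "(real ^ 'n \<Rightarrow> complex) \<Rightarrow> real ^ 'n \<Rightarrow> complex" where
  "fourier f \<xi> = (LINT x|lebesgue. exp (- (\<i> * complex_of_real (x \<bullet> \<xi>))) * f x)"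

text \<open>The kernels of the solution formula, with \<open>a\<close> standing for \<open>|\<xi>|\<^sup>2\<^sup>\<sigma>\<close>. For \<open>\<sigma> > 0\<close> the
  case \<open>a = 1\<close> is \<open>|\<xi>| = 1\<close>, where the quotient is replaced by its limit as \<open>a\<close> tends to 1.\<close>

definition kernel0 :: "real \<Rightarrow> real \<Rightarrow> real" where
  "kernel0 t a = (if a = 1 then exp (- t) + t * exp (- t)
                  else (exp (- t * a) - a * exp (- t)) / (1 - a))"

definition kernel1 :: "real \<Rightarrow> real \<Rightarrow> real" where
  "kernel1 t a = (if a = 1 then t * exp (- t)
                  else (exp (- t * a) - exp (- t)) / (1 - a))"

text \<open>The spatial Fourier transform of the solution \<open>u\<close> of
  \<open>u\<^sub>t\<^sub>t + (-\<Delta>)\<^sup>\<sigma> u + u\<^sub>t + (-\<Delta>)\<^sup>\<sigma> u\<^sub>t = 0\<close> with \<open>u(0) = u\<^sub>0\<close> and \<open>u\<^sub>t(0) = u\<^sub>1\<close>.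
  The function \<open>u\<close> is specified by this transform.\<close>

definition solution_hat ::
  "real \<Rightarrow> (real ^ 'n \<Rightarrow> complex) \<Rightarrow> (real ^ 'n \<Rightarrow> complex) \<Rightarrow> real \<Rightarrow> real ^ 'n \<Rightarrow> complex" where
  "solution_hat \<sigma> u0 u1 t \<xi> =
     complex_of_real (kernel0 t (norm \<xi> powr (2 * \<sigma>))) * fourier u0 \<xi> +
     complex_of_real (kernel1 t (norm \<xi> powr (2 * \<sigma>))) * fourier u1 \<xi>"

lemma kernel0_eq: "kernel0 t a = exp (- t) + kernel1 t a"
  by (auto simp: kernel0_def kernel1_def field_simps)

lemma exp_eq_kernels: "exp (- t * a) = kernel0 t a - a * kernel1 t a"
proof (cases "a = 1")
  case False
  have "exp (- t * a) = (1 - a) * exp (- t * a) / (1 - a)" using False by simp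
  also have "\<dots> = kernel0 t a - a * kernel1 t a"
    using False by (simp add: kernel0_def kernel1_def algebra_simps flip: diff_divide_distrib)
  finally show ?thesis .
qed (simp add: kernel0_def kernel1_def)

lemma kernel1_eq_integral:
  assumes "t \<ge> 0"
  shows "kernel1 t a = exp (- t) * integral {0..t} (\<lambda>s. exp (- s * (a - 1)))"
proof (cases "a = 1")
  case True
  with assms show ?thesis by (simp add: kernel1_def)
next
  case False
  have D: "((\<lambda>s. exp (- s * (a - 1)) / (1 - a)) has_real_derivative exp (- s * (a - 1))) (at s within A)"
    for s A
  proof -
    have "((\<lambda>s. exp (- s * (a - 1))) has_real_derivative (1 - a) * exp (- s * (a - 1))) (at s within A)"
      by (auto intro!: derivative_eq_intros simp: algebra_simps)
    from DERIV_cdivide[OF this, of "1 - a"] False show ?thesis by simp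
  qed
  have "((\<lambda>s. exp (- s * (a - 1))) has_integral
      (exp (- t * (a - 1)) / (1 - a) - exp (- 0 * (a - 1)) / (1 - a))) {0..t}"
    using assms D
    by (intro fundamental_theorem_of_calculus)
       (simp_all flip: has_real_derivative_iff_has_vector_derivative)
  hence "integral {0..t} (\<lambda>s. exp (- s * (a - 1))) = (exp (- t * (a - 1)) - 1) / (1 - a)"
    by (simp add: integral_unique diff_divide_distrib)
  moreover have "exp (- t) * exp (- t * (a - 1)) = exp (- t * a)"
    by (simp add: algebra_simps flip: exp_add)
  ultimately show ?thesis
    using False by (simp add: kernel1_def algebra_simps)
qed

lemma solution_hat_eq_integral:
  assumes "t \<ge> 0"
  shows "solution_hat \<sigma> u0 u1 t \<xi> =
    complex_of_real (exp (- t)) * fourier u0 \<xi> +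
    complex_of_real (exp (- t) * integral {0..t} (\<lambda>s. exp (- s * (norm \<xi> powr (2 * \<sigma>) - 1)))) *
      (fourier u0 \<xi> + fourier u1 \<xi>)"
  unfolding solution_hat_def kernel0_eq kernel1_eq_integral[OF assms] of_real_add
  by (simp add: algebra_simps)

text \<open>In Fourier variables the equation is \<open>w'' + (1 + a) w' + a w = 0\<close>; the kernels are its
  solutions with initial values \<open>(1, 0)\<close> and \<open>(0, 1)\<close>.\<close>

lemma kernel1_deriv:
  "((\<lambda>t. kernel1 t a) has_real_derivative (exp (- t * a) - kernel1 t a)) (at t)"
proof (cases "a = 1")
  case True
  thus ?thesis by (auto intro!: derivative_eq_intros simp: kernel1_def algebra_simps)
next
  case False
  have "((\<lambda>t. exp (- t * a) - exp (- t)) has_real_derivative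
      ((1 - a) * exp (- t * a) - (exp (- t * a) - exp (- t)))) (at t)"
    by (auto intro!: derivative_eq_intros simp: algebra_simps)
  from DERIV_cdivide[OF this, of "1 - a"] False show ?thesis
    by (simp add: kernel1_def diff_divide_distrib)
qed

lemma kernel1_deriv2:
  "((\<lambda>t. exp (- t * a) - kernel1 t a) has_real_derivative
     (- (1 + a) * (exp (- t * a) - kernel1 t a) - a * kernel1 t a)) (at t)"
  by (auto intro!: derivative_eq_intros kernel1_deriv simp: algebra_simps)

lemma kernel0_deriv:
  "((\<lambda>t. kernel0 t a) has_real_derivative (- a * kernel1 t a)) (at t)"
  unfolding kernel0_eq
  by (rule derivative_eq_intros kernel1_deriv refl)+
     (use exp_eq_kernels[of t a] kernel0_eq[of t a] in simp)

lemma kernel0_deriv2: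
  "((\<lambda>t. - a * kernel1 t a) has_real_derivative
     (- (1 + a) * (- a * kernel1 t a) - a * kernel0 t a)) (at t)"
proof -
  have "- a * (exp (- t * a) - kernel1 t a) = - (1 + a) * (- a * kernel1 t a) - a * kernel0 t a"
    unfolding exp_eq_kernels by (simp add: algebra_simps)
  with DERIV_cmult[OF kernel1_deriv, of "- a" a t] show ?thesis by simp
qed

lemma kernel_init:
  "kernel0 0 a = 1" "- a * kernel1 0 a = 0"
  "kernel1 0 a = 0" "exp (- 0 * a) - kernel1 0 a = 1"
  by (simp_all add: kernel0_def kernel1_def)

definition exponents :: "real \<Rightarrow> real set" where
  "exponents \<sigma> = {2 * \<sigma> * real l + real j | l j :: nat. True}"

fun lambda_seq :: "real \<Rightarrow> nat \<Rightarrow> real" where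
  "lambda_seq \<sigma> k = (LEAST s. s \<in> exponents \<sigma> - lambda_seq \<sigma> ` {..<k})"

declare lambda_seq.simps [simp del]

text \<open>Multi-indices are functions \<open>\<alpha> :: 'n \<Rightarrow> nat\<close>, of length \<open>sum \<alpha> UNIV\<close>.\<close>

definition moment :: "('n::finite \<Rightarrow> nat) \<Rightarrow> (real ^ 'n \<Rightarrow> complex) \<Rightarrow> complex" where
  "moment \<alpha> f = (- 1) ^ (sum \<alpha> UNIV) / (\<Prod>i\<in>UNIV. fact (\<alpha> i)) *
     (LINT x|lebesgue. complex_of_real (\<Prod>i\<in>UNIV. x $ i ^ \<alpha> i) * f x)"

text \<open>The factor \<open>|\<xi>|\<^sup>2\<^sup>\<sigma>\<^sup>l\<close> is a natural power of \<open>|\<xi>| powr (2\<sigma>)\<close>, so that it equals 1 for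
  \<open>l = 0\<close> also at \<open>\<xi> = 0\<close>, where \<open>0 powr 0 = 0\<close>.\<close>

definition profile :: "real \<Rightarrow> nat \<Rightarrow> (real ^ 'n \<Rightarrow> complex) \<Rightarrow> real ^ 'n \<Rightarrow> complex" where
  "profile \<sigma> k v \<xi> =
     (\<Sum>(l, j) \<in> {(l, j). 2 * \<sigma> * real l + real j \<le> lambda_seq \<sigma> k}.
        complex_of_real ((norm \<xi> powr (2 * \<sigma>)) ^ l) *
        (\<Sum>\<alpha> | sum \<alpha> UNIV = j. moment \<alpha> v * (\<Prod>i\<in>UNIV. (\<i> * complex_of_real (\<xi> $ i)) ^ \<alpha> i)))"

definition asymp_error ::
  "real \<Rightarrow> nat \<Rightarrow> (real ^ 'n \<Rightarrow> complex) \<Rightarrow> (real ^ 'n \<Rightarrow> complex) \<Rightarrow> real \<Rightarrow> real ^ 'n \<Rightarrow> complex" where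
  "asymp_error \<sigma> k u0 u1 t \<xi> = solution_hat \<sigma> u0 u1 t \<xi> -
     profile \<sigma> k (\<lambda>x. u0 x + u1 x) \<xi> * complex_of_real (exp (- t * norm \<xi> powr (2 * \<sigma>)))"

end

theory Submission
  imports Defs "HOL-Probability.Characteristic_Functions"
begin

text \<open>In Fourier variables put \<open>a = |\<xi>|\<^sup>2\<^sup>\<sigma>\<close> and \<open>v = u\<^sub>0 + u\<^sub>1\<close>, and write \<open>v^\<close> for the transform of
  \<open>v\<close>. For \<open>a < 1/2\<close> the solution is \<open>e\<^sup>-\<^sup>t\<^sup>a v^/(1 - a)\<close>, for \<open>a \<ge> 1/2\<close> it is \<open>0\<close>, up to errors of size
  \<open>e\<^sup>-\<^sup>t\<^sup>/\<^sup>2 (|u\<^sub>0^| + |v^|)\<close>, which the Bessel inequality controls in \<open>L\<^sup>2\<close>. Expanding \<open>1/(1 - a)\<close> as a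
  geometric series, and \<open>v^\<close> to order \<open>\<gamma> - 2\<sigma>l\<close> in the coefficient of \<open>a\<^sup>l\<close>, reproduces the profile with a
  remainder that is \<open>O(|\<xi>|\<^sup>\<gamma>)\<close>, and \<open>o(|\<xi>|\<^sup>\<gamma>)\<close> at \<open>0\<close>; for \<open>a \<ge> 1/2\<close> the profile itself is
  \<open>O(|\<xi>|\<^sup>\<gamma>)\<close>. By scaling, \<open>|\<xi>|\<^sup>2\<^sup>\<gamma> e\<^sup>-\<^sup>t\<^sup>a\<close> integrates to a constant times the power
  \<open>-(n + 2\<gamma>)/(2\<sigma>)\<close> of \<open>t\<close>.\<close>

section \<open>Gaussian integrals\<close>

text \<open>The cut at \<open>a = 1/2\<close> keeps clear of the removable singularity at
  \<open>a = 1\<close>: below it \<open>1/(1 - a)\<close> is at most 2, above it the kernel is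
  estimated through its integral form. The condition on k says that the profile consists of exactly
  the terms of homogeneity 2\<sigma>l + j at most \<gamma>, so near 0 every discarded contribution
  is O(|\<xi>|^\<gamma>). The orders \<gamma> - 2\<sigma>l need not be integers, so the Taylor
  remainder of exp(iy) is bounded by fractional powers of |y|. The little-o cannot come from one
  more Taylor term, since the next moment may not exist; it comes from dominated convergence. It
  improves the rate to a limit because for large t the heat factor concentrates the weighted
  integral at frequencies of size t^(-1/(2\<sigma>)). Squared norms are handled as integrals with
  values in the extended nonnegative reals, so that membership of the error in \<open>L2\<close> is
  a consequence of the bounds and not a prerequisite for stating them.\<close>

lemma sigma_finite_measure_completion:
  assumes "sigma_finite_measure M"
  shows "sigma_finite_measure (completion M)"
proof -
  interpret sigma_finite_measure M by fact
  obtain A where A: "countable A" "A \<subseteq> sets M" "\<Union> A = space M"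
    "\<forall>a\<in>A. emeasure M a \<noteq> \<infinity>"
    using sigma_finite_countable by blast
  show ?thesis
    by (standard, rule exI[of _ A]) (use A in \<open>auto intro!: sets_completionI_sets\<close>)
qed

text \<open>The data are only Lebesgue-measurable, so Fubini is needed for the completed measures
  themselves and not just for \<open>lborel\<close>.\<close>

interpretation lebesgue_pair: pair_sigma_finite lebesgue lebesgue
  by (intro pair_sigma_finite.intro sigma_finite_measure_completion sigma_finite_lborel)

text \<open>\<open>lborel\<close> is the image of the product of one-dimensional Lebesgue measures
  under the coordinate map, so Fubini on finite products applies factor by factor.\<close>

lemma
  fixes f :: "'a::euclidean_space \<Rightarrow> real \<Rightarrow> 'b::{real_normed_field,banach,second_countable_topology}"
  assumes "\<And>b. b \<in> Basis \<Longrightarrow> integrable lborel (f b)"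
  shows integrable_lborel_prod: "integrable lborel (\<lambda>x::'a. \<Prod>b\<in>Basis. f b (x \<bullet> b))"
    and integral_lborel_prod:
      "(LINT x|lborel. (\<Prod>b\<in>Basis. f b (x \<bullet> b))) = (\<Prod>b\<in>Basis. LINT s|lborel. f b s)"
proof -
  interpret product_sigma_finite "\<lambda>_::'a. lborel :: real measure"
    by standard (rule sigma_finite_lborel[THEN sigma_finite_measure.sigma_finite_countable])
  have [measurable]: "f b \<in> borel_measurable borel" if "b \<in> Basis" for b
    using borel_measurable_integrable[OF assms[OF that]] by simp
  have m: "(\<lambda>x::'a. \<Prod>b\<in>Basis. f b (x \<bullet> b)) \<in> borel_measurable borel"
    by measurable
  have T: "(\<lambda>g. \<Sum>b\<in>Basis. g b *\<^sub>R b) \<in> (\<Pi>\<^sub>M b\<in>(Basis::'a set). lborel) \<rightarrow>\<^sub>M borel"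
    by measurable
  have eq: "(\<Prod>b\<in>Basis. f b ((\<Sum>c\<in>Basis. g c *\<^sub>R c) \<bullet> b)) = (\<Prod>b\<in>Basis. f b (g b))"
    for g :: "'a \<Rightarrow> real"
    by (intro prod.cong refl) simp
  show "integrable lborel (\<lambda>x::'a. \<Prod>b\<in>Basis. f b (x \<bullet> b))"
    unfolding lborel_eq[where 'a='a]
    by (subst integrable_distr_eq[OF T m], unfold eq)
       (intro product_integrable_prod assms finite_Basis)
  show "(LINT x|lborel. (\<Prod>b\<in>Basis. f b (x \<bullet> b))) = (\<Prod>b\<in>Basis. LINT s|lborel. f b s)"
    unfolding lborel_eq[where 'a='a]
    by (subst integral_distr[OF T m], unfold eq)
       (intro product_integral_prod assms finite_Basis)
qed

text \<open>The substitution of e s for s reduces this to the characteristic function of the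
  standard normal distribution at z/e.\<close>

lemma
  fixes e z :: real
  assumes "e > 0"
  shows integrable_gaussian_iexp:
      "integrable lborel (\<lambda>s. complex_of_real (exp (- (e * s)\<^sup>2 / 2)) * iexp (z * s))"
    and integral_gaussian_iexp:
      "(LINT s|lborel. complex_of_real (exp (- (e * s)\<^sup>2 / 2)) * iexp (z * s)) =
        complex_of_real (sqrt (2 * pi) / e * exp (- (z / e)\<^sup>2 / 2))"
proof -
  let ?g = "\<lambda>s. complex_of_real (exp (- s\<^sup>2 / 2)) * iexp (z / e * s)"
  have i: "integrable lborel (\<lambda>s. std_normal_density s *\<^sub>R iexp (z / e * s))"
    by (rule Bochner_Integration.integrable_bound[OF integrable_normal_density[of 1 0]])
       (auto simp: abs_mult)
  have g_eq: "?g = (\<lambda>s. complex_of_real (sqrt (2 * pi)) * (std_normal_density s *\<^sub>R iexp (z / e * s)))"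
    by (auto simp: fun_eq_iff std_normal_density_def scaleR_conv_of_real field_simps)
  have g: "integrable lborel ?g"
    unfolding g_eq using i by (intro integrable_mult_right) simp
  have "(LINT s|lborel. std_normal_density s *\<^sub>R iexp (z / e * s)) = char std_normal_distribution (z / e)"
    by (simp add: char_def integral_density)
  then have gi: "(LINT s|lborel. ?g s) = complex_of_real (sqrt (2 * pi)) * exp (- (z / e)\<^sup>2 / 2)"
    unfolding g_eq integral_mult_right_zero by (simp add: char_std_normal_distribution exp_of_real)
  have sc: "?g (0 + e * s) = complex_of_real (exp (- (e * s)\<^sup>2 / 2)) * iexp (z * s)" for s
    using assms by simp
  show "integrable lborel (\<lambda>s. complex_of_real (exp (- (e * s)\<^sup>2 / 2)) * iexp (z * s))"
    using lborel_integrable_real_affine[OF g, of e 0] assms unfolding sc by simp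
  show "(LINT s|lborel. complex_of_real (exp (- (e * s)\<^sup>2 / 2)) * iexp (z * s)) =
        complex_of_real (sqrt (2 * pi) / e * exp (- (z / e)\<^sup>2 / 2))"
    using lborel_integral_real_affine[of e ?g 0] assms unfolding sc gi
    by (simp add: field_simps scaleR_conv_of_real exp_of_real)
qed

lemma prod_gaussian_inner:
  fixes x z :: "'a::euclidean_space"
  shows "(\<Prod>b\<in>Basis. complex_of_real (exp (- (e * (x \<bullet> b))\<^sup>2 / 2)) * iexp ((z \<bullet> b) * (x \<bullet> b))) =
    complex_of_real (exp (- (e * norm x)\<^sup>2 / 2)) * iexp (z \<bullet> x)"
proof -
  have "(e * norm x)\<^sup>2 = (\<Sum>b\<in>Basis. (e * (x \<bullet> b))\<^sup>2)"
    unfolding power_mult_distrib power2_norm_eq_inner euclidean_inner[of x x] sum_distrib_left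
    by (simp add: power2_eq_square)
  then have "complex_of_real (exp (- (e * norm x)\<^sup>2 / 2)) =
      (\<Prod>b\<in>Basis. complex_of_real (exp (- (e * (x \<bullet> b))\<^sup>2 / 2)))"
    by (simp add: exp_sum sum_divide_distrib flip: sum_negf)
  moreover have "iexp (z \<bullet> x) = (\<Prod>b\<in>Basis. iexp ((z \<bullet> b) * (x \<bullet> b)))"
    unfolding euclidean_inner[of z x] by (simp add: exp_sum sum_distrib_left)
  ultimately show ?thesis by (simp add: prod.distrib)
qed

lemma
  fixes z :: "'a::euclidean_space"
  assumes "e > 0"
  shows integrable_gaussian_fourier:
      "integrable lborel (\<lambda>x::'a. complex_of_real (exp (- (e * norm x)\<^sup>2 / 2)) * iexp (z \<bullet> x))"
    and integral_gaussian_fourier: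
      "(LINT x|lborel. complex_of_real (exp (- (e * norm x)\<^sup>2 / 2)) * iexp (z \<bullet> x)) =
        complex_of_real ((sqrt (2 * pi) / e) ^ DIM('a) * exp (- (norm z / e)\<^sup>2 / 2))"
proof -
  note g = integrable_gaussian_iexp[OF assms]
  show "integrable lborel (\<lambda>x::'a. complex_of_real (exp (- (e * norm x)\<^sup>2 / 2)) * iexp (z \<bullet> x))"
    using integrable_lborel_prod
      [where 'a='a and f="\<lambda>b s. complex_of_real (exp (- (e * s)\<^sup>2 / 2)) * iexp ((z \<bullet> b) * s)", OF g] unfolding prod_gaussian_inner .
  have "(LINT x|lborel. complex_of_real (exp (- (e * norm x)\<^sup>2 / 2)) * iexp (z \<bullet> x)) =
      (\<Prod>b\<in>(Basis::'a set). complex_of_real (sqrt (2 * pi) / e * exp (- ((z \<bullet> b) / e)\<^sup>2 / 2)))"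
    using integral_lborel_prod
      [where 'a='a and f="\<lambda>b s. complex_of_real (exp (- (e * s)\<^sup>2 / 2)) * iexp ((z \<bullet> b) * s)", OF g]
    unfolding prod_gaussian_inner integral_gaussian_iexp[OF assms] .
  \<comment> \<open>The trivial factors with frequency 0 give the product the shape of
    \<open>prod_gaussian_inner\<close>, which is now read backwards with width 1/e to reassemble the
    norm of z.\<close>
  also have "\<dots> = complex_of_real ((sqrt (2 * pi) / e) ^ DIM('a)) * 
      (\<Prod>b\<in>(Basis::'a set). complex_of_real (exp (- (1 / e * (z \<bullet> b))\<^sup>2 / 2)) * iexp ((0 \<bullet> b) * (z \<bullet> b)))"
    by (simp add: prod.distrib prod_dividef power_divide)
  also have "\<dots> = complex_of_real ((sqrt (2 * pi) / e) ^ DIM('a) * exp (- (norm z / e)\<^sup>2 / 2))"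
    unfolding prod_gaussian_inner by simp
  finally show "(LINT x|lborel. complex_of_real (exp (- (e * norm x)\<^sup>2 / 2)) * iexp (z \<bullet> x)) =
        complex_of_real ((sqrt (2 * pi) / e) ^ DIM('a) * exp (- (norm z / e)\<^sup>2 / 2))" .
qed

lemma
  assumes "e > 0"
  shows integrable_gaussian: "integrable lborel (\<lambda>x::'a::euclidean_space. exp (- (e * norm x)\<^sup>2 / 2))"
    and integral_gaussian:
      "(LINT x|lborel. exp (- (e * norm (x::'a))\<^sup>2 / 2)) = (sqrt (2 * pi) / e) ^ DIM('a)"
proof -
  show "integrable lborel (\<lambda>x::'a::euclidean_space. exp (- (e * norm x)\<^sup>2 / 2))"
    using integrable_norm[OF integrable_gaussian_fourier[OF assms, of "0::'a"]] by simp
  show "(LINT x|lborel. exp (- (e * norm (x::'a))\<^sup>2 / 2)) = (sqrt (2 * pi) / e) ^ DIM('a)"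
    using integral_gaussian_fourier[OF assms, of "0::'a"]
    unfolding of_real_eq_iff[where 'a=complex, symmetric] by (simp del: of_real_power)
qed

section \<open>Bessel inequality for the Fourier transform\<close>

text \<open>Without integrability the left side is 0 by convention, so inner integrals can be
  estimated before anything is known about their convergence.\<close>

lemma norm_integral_le_nn_integral:
  fixes f :: "_ \<Rightarrow> 'a::{banach, second_countable_topology}"
  shows "ennreal (norm (integral\<^sup>L M f)) \<le> (\<integral>\<^sup>+x. ennreal (norm (f x)) \<partial>M)"
  by (cases "integrable M f") (auto simp: integral_norm_bound_ennreal not_integrable_integral_eq)

section \<open>Measurability and Fubini for oscillating kernels over the completed measure\<close>

lemma borel_measurable_lebesgue_comp:
  "f \<in> borel_measurable borel \<Longrightarrow> f \<in> borel_measurable lebesgue"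
  by (simp add: measurable_completion)

lemma lebesgue_pair_borel_measurable:
  assumes f: "f \<in> borel_measurable (borel \<Otimes>\<^sub>M borel)"
  shows "f \<in> borel_measurable (lebesgue \<Otimes>\<^sub>M lebesgue)"
proof -
  have [measurable]: "(\<lambda>x. x) \<in> lebesgue \<rightarrow>\<^sub>M borel"
    by (simp add: measurable_completion)
  have "(\<lambda>p. (fst p, snd p)) \<in> lebesgue \<Otimes>\<^sub>M lebesgue \<rightarrow>\<^sub>M borel \<Otimes>\<^sub>M borel"
    by measurable
  from measurable_compose[OF this f] show ?thesis by simp
qed

text \<open>Domination by the tensor product of h and g. The kernels K of interest are unimodular
  characters.\<close>

lemma lebesgue_pair_integrable_kernel:
  fixes h :: "'a::euclidean_space \<Rightarrow> complex" and g :: "'b::euclidean_space \<Rightarrow> complex"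
  assumes h: "integrable lebesgue h" and g: "integrable lebesgue g"
    and K: "case_prod K \<in> borel_measurable (borel \<Otimes>\<^sub>M borel)" and "\<And>x y. norm (K x y) \<le> 1"
  shows "integrable (lebesgue \<Otimes>\<^sub>M lebesgue) (\<lambda>(x, y). h x * (g y * K x y))"
proof -
  note [measurable] = borel_measurable_integrable[OF h] borel_measurable_integrable[OF g]
    lebesgue_pair_borel_measurable[OF K]
  have hg: "integrable (lebesgue \<Otimes>\<^sub>M lebesgue) (\<lambda>(x, y). h x * g y)"
  proof (rule lebesgue_pair.Fubini_integrable)
    show "integrable lebesgue (\<lambda>x. LINT y|lebesgue. norm (case (x, y) of (x, y) \<Rightarrow> h x * g y))"
      using h by (simp add: norm_mult integrable_norm)
    show "AE x in lebesgue. integrable lebesgue (\<lambda>y. case (x, y) of (x, y) \<Rightarrow> h x * g y)"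
      using g by simp
  qed measurable
  have m: "(\<lambda>(x, y). h x * (g y * K x y)) \<in> borel_measurable (lebesgue \<Otimes>\<^sub>M lebesgue)"
    by measurable
  show ?thesis
    using assms(4)
    by (intro Bochner_Integration.integrable_bound[OF hg m])
       (auto simp: norm_mult intro!: AE_I2 mult_left_mono mult_left_le)
qed

lemma iexp_inner_measurable:
  "(\<lambda>(x, y). exp (- (\<i> * complex_of_real ((x::'a::euclidean_space) \<bullet> y))))
     \<in> borel_measurable (borel \<Otimes>\<^sub>M borel)"
  by measurable

lemma borel_measurable_fourier:
  assumes "integrable lebesgue f"
  shows "fourier f \<in> borel_measurable lebesgue"
proof -
  note [measurable] = borel_measurable_integrable[OF assms]
    lebesgue_pair_borel_measurable[OF iexp_inner_measurable]
  have "(\<lambda>(\<xi>, x). exp (- (\<i> * complex_of_real (\<xi> \<bullet> x))) * f x)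
      \<in> borel_measurable (lebesgue \<Otimes>\<^sub>M lebesgue)"
    by measurable
  then have "(\<lambda>(\<xi>, x). exp (- (\<i> * complex_of_real (x \<bullet> \<xi>))) * f x)
      \<in> borel_measurable (lebesgue \<Otimes>\<^sub>M lebesgue)"
    by (simp add: inner_commute)
  then show ?thesis
    unfolding fourier_def[abs_def]
    by (rule sigma_finite_measure.borel_measurable_lebesgue_integral
        [OF sigma_finite_measure_completion[OF sigma_finite_lborel]])
qed

lemma integrable_fourier_kernel:
  fixes f :: "real ^ 'n \<Rightarrow> complex"
  assumes "integrable lebesgue f"
  shows "integrable lebesgue (\<lambda>x. exp (- (\<i> * complex_of_real (x \<bullet> \<xi>))) * f x)"
proof (rule Bochner_Integration.integrable_bound[OF assms])
  have "(\<lambda>x. exp (- (\<i> * complex_of_real (x \<bullet> \<xi>)))) \<in> borel_measurable borel"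
    by measurable
  from borel_measurable_lebesgue_comp[OF this] borel_measurable_integrable[OF assms]
  show "(\<lambda>x. exp (- (\<i> * complex_of_real (x \<bullet> \<xi>))) * f x) \<in> borel_measurable lebesgue"
    by (rule borel_measurable_times)
qed (simp add: norm_mult)

lemma norm_fourier_le:
  assumes "integrable lebesgue f"
  shows "norm (fourier f \<xi>) \<le> (LINT x|lebesgue. norm (f x))"
  unfolding fourier_def
  using integral_norm_bound[of lebesgue "\<lambda>x. exp (- (\<i> * complex_of_real (x \<bullet> \<xi>))) * f x"]
  by (simp add: norm_mult)

lemma
  assumes "e > 0"
  shows integrable_lebesgue_gaussian:
      "integrable lebesgue (\<lambda>x::'a::euclidean_space. exp (- (e * norm x)\<^sup>2 / 2))"
    and nn_integral_gaussian_translate: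
      "(\<integral>\<^sup>+y. ennreal (exp (- (e * norm (y - (x::'a)))\<^sup>2 / 2)) \<partial>lebesgue)
         = ennreal ((sqrt (2 * pi) / e) ^ DIM('a))"
proof -
  show "integrable lebesgue (\<lambda>x::'a. exp (- (e * norm x)\<^sup>2 / 2))"
    using integrable_gaussian[OF assms, where 'a='a] by (simp add: integrable_completion)
  have "(\<integral>\<^sup>+y. ennreal (exp (- (e * norm (y - x))\<^sup>2 / 2)) \<partial>lebesgue)
      = (\<integral>\<^sup>+y. ennreal (exp (- (e * norm (y - x))\<^sup>2 / 2)) \<partial>distr lborel borel ((+) x))"
    unfolding nn_integral_completion lborel_distr_plus ..
  also have "\<dots> = (\<integral>\<^sup>+y. ennreal (exp (- (e * norm y)\<^sup>2 / 2)) \<partial>(lborel :: 'a measure))"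
    by (subst nn_integral_distr) auto
  also have "\<dots> = ennreal ((sqrt (2 * pi) / e) ^ DIM('a))"
    by (subst nn_integral_eq_integral[OF integrable_gaussian[OF assms]])
       (simp_all only: integral_gaussian[OF assms] exp_ge_zero AE_I2)
  finally show "(\<integral>\<^sup>+y. ennreal (exp (- (e * norm (y - x))\<^sup>2 / 2)) \<partial>lebesgue)
         = ennreal ((sqrt (2 * pi) / e) ^ DIM('a))" .
qed

text \<open>Inserting a Gaussian weight makes all integrals absolutely convergent; Fubini then turns the
  weighted norm of \<open>fourier f\<close> into a double integral of \<open>f\<close> against a positive kernel of total mass
  \<open>(2\<pi>)\<^sup>n\<close>, whatever the width \<open>e\<close>.\<close>

lemma fourier_gaussian_weighted:
  fixes f :: "real ^ 'n \<Rightarrow> complex"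
  assumes f: "integrable lebesgue f" and "e > 0"
  shows "integrable lebesgue (\<lambda>\<xi>. exp (- (e * norm \<xi>)\<^sup>2 / 2) * (norm (fourier f \<xi>))\<^sup>2)" 
    and "complex_of_real (LINT \<xi>|lebesgue. exp (- (e * norm \<xi>)\<^sup>2 / 2) * (norm (fourier f \<xi>))\<^sup>2) =
      (LINT x|lebesgue. f x * (LINT y|lebesgue. cnj (f y) *
         complex_of_real ((sqrt (2 * pi) / e) ^ CARD('n) * exp (- (norm (y - x) / e)\<^sup>2 / 2))))"
proof -
  let ?\<phi> = "\<lambda>\<xi>::real^'n. complex_of_real (exp (- (e * norm \<xi>)\<^sup>2 / 2))"
  let ?E = "\<lambda>(x::real^'n) \<xi>. exp (- (\<i> * complex_of_real (x \<bullet> \<xi>)))"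
  let ?g = "\<lambda>\<xi>. cnj (fourier f \<xi>) * ?\<phi> \<xi>"
  note [measurable] = borel_measurable_fourier[OF f]
  have \<phi>: "integrable lebesgue ?\<phi>"
    using integrable_lebesgue_gaussian[OF assms(2), where 'a="real^'n"] by (rule integrable_of_real)
  note \<phi>m = borel_measurable_integrable[OF \<phi>]
  have fm: "(\<lambda>\<xi>. cnj (fourier f \<xi>)) \<in> borel_measurable lebesgue"
    by (rule measurable_compose[OF borel_measurable_fourier[OF f]])
       (intro borel_measurable_continuous_onI continuous_intros)
  \<comment> \<open>For an L^1 function only boundedness of the transform is available; the Gaussian
    supplies all the decay.\<close>
  have g: "integrable lebesgue ?g"
    using norm_fourier_le[OF f]
    by (intro Bochner_Integration.integrable_bound
          [OF integrable_mult_right[OF \<phi>, of "complex_of_real (LINT x|lebesgue. norm (f x))"]])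
       (rule borel_measurable_times[OF fm \<phi>m],
        simp add: norm_mult mult_right_mono abs_of_nonneg integral_nonneg_AE)
  have cf: "integrable lebesgue (\<lambda>y. cnj (f y))" using f by simp
  have sq: "?g \<xi> * fourier f \<xi> = complex_of_real (exp (- (e * norm \<xi>)\<^sup>2 / 2) * (norm (fourier f \<xi>))\<^sup>2)" for \<xi>
    by (simp add: complex_norm_square mult_ac del: of_real_power)
  have "integrable lebesgue (\<lambda>\<xi>. ?g \<xi> * fourier f \<xi>)"
    using norm_fourier_le[OF f]
    by (intro Bochner_Integration.integrable_bound
          [OF integrable_mult_right[OF g, of "complex_of_real (LINT x|lebesgue. norm (f x))"]])
       (rule borel_measurable_times[OF borel_measurable_integrable[OF g] borel_measurable_fourier[OF f]],
        subst norm_mult, subst norm_mult, subst mult.commute,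
        auto simp: integral_nonneg_AE intro!: AE_I2 mult_right_mono)
  then show "integrable lebesgue (\<lambda>\<xi>. exp (- (e * norm \<xi>)\<^sup>2 / 2) * (norm (fourier f \<xi>))\<^sup>2)"
    unfolding sq complex_of_real_integrable_eq .
  have mult_fourier: "c * fourier f \<xi> = (LINT x|lebesgue. f x * (c * ?E x \<xi>))" for c \<xi>
    unfolding fourier_def integral_mult_right_zero[symmetric] by (simp only: mult_ac)
  have mult_cnj: "cnj (a * b) * (c * d) = cnj b * (c * (cnj a * d))" for a b c d
    by simp
  \<comment> \<open>Writing the conjugated transform as an integral over y combines the two
    characters into one at y - x, so that the \<xi>-integral becomes the transform of a
    Gaussian.\<close>
  have inner: "(LINT \<xi>|lebesgue. ?g \<xi> * ?E x \<xi>) = (LINT y|lebesgue. cnj (f y) *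
         complex_of_real ((sqrt (2 * pi) / e) ^ CARD('n) * exp (- (norm (y - x) / e)\<^sup>2 / 2)))" for x
  proof -
    let ?K = "\<lambda>y \<xi>. iexp ((y - x) \<bullet> \<xi>)"
    have eq: "?g \<xi> * ?E x \<xi> = (LINT y|lebesgue. cnj (f y) * (?\<phi> \<xi> * ?K y \<xi>))" for \<xi>
    proof -
      have "cnj (fourier f \<xi>) = (LINT y|lebesgue. cnj (?E y \<xi> * f y))"
        unfolding fourier_def by (rule Bochner_Integration.integral_cnj[symmetric])
      also have "\<dots> * (?\<phi> \<xi> * ?E x \<xi>) = (LINT y|lebesgue. cnj (?E y \<xi> * f y) * (?\<phi> \<xi> * ?E x \<xi>))"
        by (rule integral_mult_left_zero[symmetric])
      also have "\<dots> = (LINT y|lebesgue. cnj (f y) * (?\<phi> \<xi> * ?K y \<xi>))"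
      proof (intro Bochner_Integration.integral_cong refl)
        fix y
        have "cnj (?E y \<xi>) * ?E x \<xi> = ?K y \<xi>"
          by (simp add: exp_cnj inner_diff_left right_diff_distrib flip: exp_add)
        then show "cnj (?E y \<xi> * f y) * (?\<phi> \<xi> * ?E x \<xi>) = cnj (f y) * (?\<phi> \<xi> * ?K y \<xi>)"
          using mult_cnj[of "?E y \<xi>" "f y" "?\<phi> \<xi>" "?E x \<xi>"] by (simp only:)
      qed
      finally show ?thesis by (simp only: mult.assoc)
    qed
    have "(LINT \<xi>|lebesgue. ?g \<xi> * ?E x \<xi>) =
        (LINT \<xi>|lebesgue. LINT y|lebesgue. cnj (f y) * (?\<phi> \<xi> * ?K y \<xi>))"
      unfolding eq ..
    also have "\<dots> = (LINT y|lebesgue. LINT \<xi>|lebesgue. cnj (f y) * (?\<phi> \<xi> * ?K y \<xi>))"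
    proof (rule lebesgue_pair.Fubini_integral, rule lebesgue_pair_integrable_kernel[OF cf \<phi>])
      show "(\<lambda>(y, \<xi>). ?K y \<xi>) \<in> borel_measurable (borel \<Otimes>\<^sub>M borel)" by measurable
    qed simp
    also have "\<dots> = (LINT y|lebesgue. cnj (f y) * (LINT \<xi>|lborel. ?\<phi> \<xi> * ?K y \<xi>))"
      by (simp add: integral_completion)
    finally show ?thesis
      unfolding integral_gaussian_fourier[OF assms(2)] by simp
  qed
  have "complex_of_real (LINT \<xi>|lebesgue. exp (- (e * norm \<xi>)\<^sup>2 / 2) * (norm (fourier f \<xi>))\<^sup>2) =
      (LINT \<xi>|lebesgue. ?g \<xi> * fourier f \<xi>)"
    unfolding sq integral_complex_of_real ..
  also have "\<dots> = (LINT \<xi>|lebesgue. LINT x|lebesgue. f x * (?g \<xi> * ?E x \<xi>))"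
    unfolding mult_fourier ..
  also have "\<dots> = (LINT x|lebesgue. LINT \<xi>|lebesgue. f x * (?g \<xi> * ?E x \<xi>))"
    by (rule lebesgue_pair.Fubini_integral, rule lebesgue_pair_integrable_kernel[OF f g])
       (rule iexp_inner_measurable, simp)
  finally show "complex_of_real (LINT \<xi>|lebesgue. exp (- (e * norm \<xi>)\<^sup>2 / 2) * (norm (fourier f \<xi>))\<^sup>2) =
      (LINT x|lebesgue. f x * (LINT y|lebesgue. cnj (f y) *
         complex_of_real ((sqrt (2 * pi) / e) ^ CARD('n) * exp (- (norm (y - x) / e)\<^sup>2 / 2))))"
    unfolding integral_mult_right_zero inner .
qed

text \<open>Schur's test: split |f(x)||f(y)| into half the sum of the squares. The kernel is
  symmetric, so both halves contribute half of its mass times the squared norm of f.\<close>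

lemma fourier_gaussian_weighted_le:
  fixes f :: "real ^ 'n \<Rightarrow> complex"
  assumes f: "integrable lebesgue f" and "e > 0"
  shows "(\<integral>\<^sup>+\<xi>. ennreal (exp (- (e * norm \<xi>)\<^sup>2 / 2) * (norm (fourier f \<xi>))\<^sup>2) \<partial>lebesgue) \<le>
     ennreal ((2 * pi) ^ CARD('n)) * (\<integral>\<^sup>+x. ennreal ((norm (f x))\<^sup>2) \<partial>lebesgue)"
proof -
  define c where "c = (sqrt (2 * pi) / e) ^ CARD('n)"
  let ?G = "\<lambda>x y::real^'n. c * exp (- (norm (y - x) / e)\<^sup>2 / 2)"
  have c: "c \<ge> 0" using assms by (simp add: c_def)
  note [measurable] = borel_measurable_integrable[OF f]
  have "(\<lambda>(x, y). ?G x y) \<in> borel_measurable (borel \<Otimes>\<^sub>M borel)" by measurable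
  note [measurable] = lebesgue_pair_borel_measurable[OF this]
  have G_nn: "(\<integral>\<^sup>+y. ennreal (?G x y) \<partial>lebesgue) = ennreal ((2 * pi) ^ CARD('n))" for x
  proof -
    have "(\<integral>\<^sup>+y. ennreal (?G x y) \<partial>lebesgue) =
        ennreal c * (\<integral>\<^sup>+y. ennreal (exp (- (1 / e * norm (y - x))\<^sup>2 / 2)) \<partial>lebesgue)"
      using c by (subst nn_integral_cmult[symmetric]) 
        (auto simp: ennreal_mult intro!: borel_measurable_lebesgue_comp)
    also have "\<dots> = ennreal (c * (sqrt (2 * pi) / (1 / e)) ^ CARD('n))"
      using assms c by (subst nn_integral_gaussian_translate) (simp_all add: ennreal_mult)
    \<comment> \<open>The factor 1/e of the transformed Gaussian cancels the factor e of its
      integral; hence the bound is uniform in e.\<close>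
    also have "c * (sqrt (2 * pi) / (1 / e)) ^ CARD('n) = (2 * pi) ^ CARD('n)"
      using assms unfolding c_def power_mult_distrib[symmetric] by simp
    finally show ?thesis .
  qed
  have half: "(\<integral>\<^sup>+x. \<integral>\<^sup>+y. ennreal ((norm (f x))\<^sup>2 / 2 * ?G x y) \<partial>lebesgue \<partial>lebesgue) =
      ennreal ((2 * pi) ^ CARD('n)) * (\<integral>\<^sup>+x. ennreal ((norm (f x))\<^sup>2 / 2) \<partial>lebesgue)"
  proof -
    have "(\<integral>\<^sup>+x. \<integral>\<^sup>+y. ennreal ((norm (f x))\<^sup>2 / 2 * ?G x y) \<partial>lebesgue \<partial>lebesgue) =
        (\<integral>\<^sup>+x. ennreal ((norm (f x))\<^sup>2 / 2) * (\<integral>\<^sup>+y. ennreal (?G x y) \<partial>lebesgue) \<partial>lebesgue)"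
    proof (intro nn_integral_cong)
      fix x
      have "(\<lambda>y. ennreal (?G x y)) \<in> borel_measurable borel" by measurable
      from nn_integral_cmult[OF borel_measurable_lebesgue_comp[OF this]]
      show "(\<integral>\<^sup>+y. ennreal ((norm (f x))\<^sup>2 / 2 * ?G x y) \<partial>lebesgue) =
          ennreal ((norm (f x))\<^sup>2 / 2) * (\<integral>\<^sup>+y. ennreal (?G x y) \<partial>lebesgue)"
        by (subst ennreal_mult') simp_all
    qed
    also have "\<dots> = (\<integral>\<^sup>+x. ennreal ((norm (f x))\<^sup>2 / 2) \<partial>lebesgue) * ennreal ((2 * pi) ^ CARD('n))"
      unfolding G_nn by (rule nn_integral_multc) measurable
    finally show ?thesis by (simp add: mult.commute)
  qed
  have "(\<integral>\<^sup>+\<xi>. ennreal (exp (- (e * norm \<xi>)\<^sup>2 / 2) * (norm (fourier f \<xi>))\<^sup>2) \<partial>lebesgue) =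
      ennreal (LINT \<xi>|lebesgue. exp (- (e * norm \<xi>)\<^sup>2 / 2) * (norm (fourier f \<xi>))\<^sup>2)"
    by (rule nn_integral_eq_integral[OF fourier_gaussian_weighted(1)[OF assms]]) simp
  also have "\<dots> = ennreal (norm (LINT x|lebesgue. f x * (LINT y|lebesgue. cnj (f y) * complex_of_real (?G x y))))"
    unfolding c_def fourier_gaussian_weighted(2)[OF assms, symmetric] by simp
  also have "\<dots> \<le> (\<integral>\<^sup>+x. ennreal (norm (f x * (LINT y|lebesgue. cnj (f y) * complex_of_real (?G x y)))) \<partial>lebesgue)"
    by (rule norm_integral_le_nn_integral)
  also have "\<dots> \<le> (\<integral>\<^sup>+x. \<integral>\<^sup>+y. ennreal (norm (f x) * norm (f y) * ?G x y) \<partial>lebesgue \<partial>lebesgue)"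
  proof (intro nn_integral_mono)
    fix x
    have "(\<lambda>y. ?G x y) \<in> borel_measurable borel" by measurable
    note [measurable] = borel_measurable_lebesgue_comp[OF this]
    have "ennreal (norm (f x * (LINT y|lebesgue. cnj (f y) * complex_of_real (?G x y)))) \<le>
        ennreal (norm (f x)) * (\<integral>\<^sup>+y. ennreal (norm (cnj (f y) * complex_of_real (?G x y))) \<partial>lebesgue)"
      unfolding norm_mult[of "f x"]
      by (subst ennreal_mult) (auto intro!: mult_left_mono norm_integral_le_nn_integral)
    also have "\<dots> = ennreal (norm (f x)) * (\<integral>\<^sup>+y. ennreal (norm (f y) * ?G x y) \<partial>lebesgue)"
      using c by (simp add: norm_mult abs_mult)
    also have "\<dots> = (\<integral>\<^sup>+y. ennreal (norm (f x)) * ennreal (norm (f y) * ?G x y) \<partial>lebesgue)"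
      by (rule nn_integral_cmult[symmetric]) measurable
    also have "\<dots> = (\<integral>\<^sup>+y. ennreal (norm (f x) * norm (f y) * ?G x y) \<partial>lebesgue)"
      by (simp only: ennreal_mult'[symmetric] norm_ge_zero mult.assoc)
    finally show "ennreal (norm (f x * (LINT y|lebesgue. cnj (f y) * complex_of_real (?G x y)))) \<le>
      (\<integral>\<^sup>+y. ennreal (norm (f x) * norm (f y) * ?G x y) \<partial>lebesgue)" .
  qed
  also have "\<dots> \<le> (\<integral>\<^sup>+x. \<integral>\<^sup>+y. ennreal ((norm (f x))\<^sup>2 / 2 * ?G x y) + ennreal ((norm (f y))\<^sup>2 / 2 * ?G x y)
      \<partial>lebesgue \<partial>lebesgue)"
  proof (intro nn_integral_mono)
    fix x y
    have "norm (f x) * norm (f y) \<le> (norm (f x))\<^sup>2 / 2 + (norm (f y))\<^sup>2 / 2"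
      using sum_squares_bound[of "norm (f x)" "norm (f y)"] by simp
    then have "norm (f x) * norm (f y) * ?G x y \<le> ((norm (f x))\<^sup>2 / 2 + (norm (f y))\<^sup>2 / 2) * ?G x y"
      using c by (intro mult_right_mono) auto
    then show "ennreal (norm (f x) * norm (f y) * ?G x y) \<le>
        ennreal ((norm (f x))\<^sup>2 / 2 * ?G x y) + ennreal ((norm (f y))\<^sup>2 / 2 * ?G x y)"
      using c by (simp add: ennreal_leI distrib_right flip: ennreal_plus)
  qed
  also have "\<dots> = (\<integral>\<^sup>+x. \<integral>\<^sup>+y. ennreal ((norm (f x))\<^sup>2 / 2 * ?G x y) \<partial>lebesgue \<partial>lebesgue) +
      (\<integral>\<^sup>+x. \<integral>\<^sup>+y. ennreal ((norm (f y))\<^sup>2 / 2 * ?G x y) \<partial>lebesgue \<partial>lebesgue)"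
  proof -
    \<comment> \<open>The sum is split on the product space, where measurability is evident, rather
      than in the iterated integral.\<close>
    let ?A = "\<lambda>(x, y). ennreal ((norm (f x))\<^sup>2 / 2 * ?G x y)"
      and ?B = "\<lambda>(x, y). ennreal ((norm (f y))\<^sup>2 / 2 * ?G x y)"
    have A: "?A \<in> borel_measurable (lebesgue \<Otimes>\<^sub>M lebesgue)" by measurable
    have B: "?B \<in> borel_measurable (lebesgue \<Otimes>\<^sub>M lebesgue)" by measurable
    note fst = sigma_finite_measure.nn_integral_fst
        [OF sigma_finite_measure_completion[OF sigma_finite_lborel]]
    show ?thesis
      using nn_integral_add[OF A B] fst[OF borel_measurable_add[OF A B]] fst[OF A] fst[OF B]
      by (simp only: prod.case)
  qed
  \<comment> \<open>Exchange of the integrations together with the symmetry of the kernel.\<close>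
  also have "(\<integral>\<^sup>+x. \<integral>\<^sup>+y. ennreal ((norm (f y))\<^sup>2 / 2 * ?G x y) \<partial>lebesgue \<partial>lebesgue) =
      (\<integral>\<^sup>+x. \<integral>\<^sup>+y. ennreal ((norm (f x))\<^sup>2 / 2 * ?G x y) \<partial>lebesgue \<partial>lebesgue)"
  proof -
    have "(\<lambda>(x, y). ?G y x) \<in> borel_measurable (borel \<Otimes>\<^sub>M borel)" by measurable
    note [measurable] = lebesgue_pair_borel_measurable[OF this]
    have "(\<lambda>(x, y). ennreal ((norm (f x))\<^sup>2 / 2 * ?G y x)) \<in> borel_measurable (lebesgue \<Otimes>\<^sub>M lebesgue)"
      by measurable
    from lebesgue_pair.Fubini'[OF this] show ?thesis
      by (simp only: norm_minus_commute)
  qed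
  also have "(\<integral>\<^sup>+x. \<integral>\<^sup>+y. ennreal ((norm (f x))\<^sup>2 / 2 * ?G x y) \<partial>lebesgue \<partial>lebesgue) + \<dots> =
      ennreal ((2 * pi) ^ CARD('n)) * (\<integral>\<^sup>+x. ennreal ((norm (f x))\<^sup>2 / 2) + ennreal ((norm (f x))\<^sup>2 / 2) \<partial>lebesgue)"
    unfolding half by (subst nn_integral_add) (measurable, simp only: distrib_left)
  also have "\<dots> = ennreal ((2 * pi) ^ CARD('n)) * (\<integral>\<^sup>+x. ennreal ((norm (f x))\<^sup>2) \<partial>lebesgue)"
    by (simp flip: ennreal_plus)
  finally show ?thesis .
qed

text \<open>Fatou's lemma along the widths 1/(k+1), whose weights tend to 1, applied to the bound
  that is uniform in the width. For f outside L^2 the right side is infinite.\<close>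

lemma nn_integral_fourier_le:
  fixes f :: "real ^ 'n \<Rightarrow> complex"
  assumes f: "integrable lebesgue f"
  shows "(\<integral>\<^sup>+\<xi>. ennreal ((norm (fourier f \<xi>))\<^sup>2) \<partial>lebesgue) \<le>
     ennreal ((2 * pi) ^ CARD('n)) * (\<integral>\<^sup>+x. ennreal ((norm (f x))\<^sup>2) \<partial>lebesgue)" (is "_ \<le> ?C")
proof -
  let ?u = "\<lambda>k \<xi>. ennreal (exp (- (inverse (real (Suc k)) * norm \<xi>)\<^sup>2 / 2) * (norm (fourier f \<xi>))\<^sup>2)"
  note [measurable] = borel_measurable_fourier[OF f]
  have u: "(\<lambda>k. ?u k \<xi>) \<longlonglongrightarrow> ennreal ((norm (fourier f \<xi>))\<^sup>2)" for \<xi>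
  proof -
    have "(\<lambda>k. exp (- (inverse (real (Suc k)) * norm \<xi>)\<^sup>2 / 2) * (norm (fourier f \<xi>))\<^sup>2)
      \<longlonglongrightarrow> exp (- (0 * norm \<xi>)\<^sup>2 / 2) * (norm (fourier f \<xi>))\<^sup>2"
      by (intro tendsto_intros LIMSEQ_inverse_real_of_nat) simp
    then show ?thesis by (intro tendsto_ennrealI) simp
  qed
  have "(\<integral>\<^sup>+\<xi>. ennreal ((norm (fourier f \<xi>))\<^sup>2) \<partial>lebesgue) = (\<integral>\<^sup>+\<xi>. liminf (\<lambda>k. ?u k \<xi>) \<partial>lebesgue)"
    using lim_imp_Liminf[OF sequentially_bot u] by simp
  also have "\<dots> \<le> liminf (\<lambda>k. \<integral>\<^sup>+\<xi>. ?u k \<xi> \<partial>lebesgue)"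
    by (intro nn_integral_liminf) (measurable, auto intro!: borel_measurable_lebesgue_comp)
  also have "\<dots> \<le> ?C"
    by (intro order_trans[OF Liminf_le_Limsup Limsup_bounded] always_eventually allI
          fourier_gaussian_weighted_le[OF f]) auto
  finally show ?thesis .
qed

section \<open>Moments and Taylor expansion of the Fourier transform\<close>

text \<open>The divided form \<open>z\<^sup>j/j!\<close> makes the induction step a plain binomial expansion.\<close>

lemma multinomial_divided_power_on:
  fixes z :: "'i \<Rightarrow> 'a::field_char_0"
  assumes "finite A"
  shows "finite {\<alpha> :: 'i \<Rightarrow> nat. (\<forall>i. i \<notin> A \<longrightarrow> \<alpha> i = 0) \<and> sum \<alpha> A = j} \<and>
    (\<Sum>i\<in>A. z i) ^ j / fact j =
      (\<Sum>\<alpha> | (\<forall>i. i \<notin> A \<longrightarrow> \<alpha> i = 0) \<and> sum \<alpha> A = j. \<Prod>i\<in>A. z i ^ \<alpha> i / fact (\<alpha> i))"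
  using assms
proof (induction A arbitrary: j rule: finite_induct)
  case empty
  have "{\<alpha> :: 'i \<Rightarrow> nat. (\<forall>i. i \<notin> {} \<longrightarrow> \<alpha> i = 0) \<and> sum \<alpha> {} = j} = (if j = 0 then {\<lambda>_. 0} else {})"
    by (auto simp: fun_eq_iff)
  then show ?case by simp
next
  case (insert a A)
  let ?S = "\<lambda>A j. {\<alpha> :: 'i \<Rightarrow> nat. (\<forall>i. i \<notin> A \<longrightarrow> \<alpha> i = 0) \<and> sum \<alpha> A = j}"
  let ?T = "SIGMA k:{..j}. ?S A (j - k)"
  let ?u = "\<lambda>(k, \<alpha>). \<alpha>(a := k)"
  \<comment> \<open>A multi-index on \<open>insert a A\<close> is its value k at a together with a
    multi-index of length j - k on A. Vanishing outside the index set makes this decomposition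
    unique.\<close>
  have bij: "bij_betw ?u ?T (?S (insert a A) j)"
  proof (rule bij_betw_byWitness[where f' = "\<lambda>\<alpha>. (\<alpha> a, \<alpha>(a := 0))"])
    show "\<forall>p\<in>?T. (\<lambda>\<alpha>. (\<alpha> a, \<alpha>(a := 0))) (?u p) = p"
      using insert.hyps by (auto simp: fun_eq_iff)
    show "\<forall>\<alpha>\<in>?S (insert a A) j. ?u ((\<lambda>\<alpha>. (\<alpha> a, \<alpha>(a := 0))) \<alpha>) = \<alpha>"
      by auto
    have "sum (\<alpha>(a := k)) A = sum \<alpha> A" for \<alpha> :: "'i \<Rightarrow> nat" and k
      using insert.hyps by (intro sum.cong) auto
    then show "?u ` ?T \<subseteq> ?S (insert a A) j" "(\<lambda>\<alpha>. (\<alpha> a, \<alpha>(a := 0))) ` ?S (insert a A) j \<subseteq> ?T"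
      using insert.hyps by auto
  qed
  \<comment> \<open>Finiteness has to travel with the identity: a sum over an infinite set is 0 by
    default.\<close>
  have "finite ?T"
    using insert.IH by auto
  then have fin: "finite (?S (insert a A) j)"
    using bij bij_betw_finite by blast
  have "(\<Sum>i\<in>insert a A. z i) ^ j / fact j =
      (\<Sum>k\<le>j. z a ^ k / fact k * ((\<Sum>i\<in>A. z i) ^ (j - k) / fact (j - k)))"
    using insert.hyps by (simp add: binomial_ring binomial_fact sum_divide_distrib)
  also have "\<dots> = (\<Sum>(k, \<alpha>)\<in>?T. z a ^ k / fact k * (\<Prod>i\<in>A. z i ^ \<alpha> i / fact (\<alpha> i)))"
    unfolding insert.IH[THEN conjunct2] sum_distrib_left using insert.IH by (subst sum.Sigma) auto
  also have "\<dots> = (\<Sum>p\<in>?T. \<Prod>i\<in>insert a A. z i ^ (?u p) i / fact ((?u p) i))"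
  proof (intro sum.cong refl)
    fix p assume "p \<in> ?T"
    obtain k \<alpha> where p: "p = (k, \<alpha>)" by fastforce
    have "(\<Prod>i\<in>A. z i ^ (\<alpha>(a := k)) i / fact ((\<alpha>(a := k)) i)) = (\<Prod>i\<in>A. z i ^ \<alpha> i / fact (\<alpha> i))"
      using insert.hyps by (intro prod.cong) auto
    then show "(case p of (k, \<alpha>) \<Rightarrow> z a ^ k / fact k * (\<Prod>i\<in>A. z i ^ \<alpha> i / fact (\<alpha> i))) =
        (\<Prod>i\<in>insert a A. z i ^ (?u p) i / fact ((?u p) i))"
      unfolding p using insert.hyps by simp
  qed
  also have "\<dots> = (\<Sum>\<alpha>\<in>?S (insert a A) j. \<Prod>i\<in>insert a A. z i ^ \<alpha> i / fact (\<alpha> i))"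
    by (rule sum.reindex_bij_betw[OF bij])
  finally have "(\<Sum>i\<in>insert a A. z i) ^ j / fact j =
      (\<Sum>\<alpha>\<in>?S (insert a A) j. \<Prod>i\<in>insert a A. z i ^ \<alpha> i / fact (\<alpha> i))" .
  with fin show ?case by blast
qed

lemma multinomial_divided_power:
  fixes z :: "'n::finite \<Rightarrow> 'a::field_char_0"
  shows "(\<Sum>i\<in>UNIV. z i) ^ j / fact j =
      (\<Sum>\<alpha> | sum \<alpha> UNIV = j. \<Prod>i\<in>UNIV. z i ^ \<alpha> i / fact (\<alpha> i))"
  using multinomial_divided_power_on[of "UNIV :: 'n set" j z] by simp

text \<open>The common source of integrability for moments and Taylor remainders: growth of g at
  most that of the weight is absorbed by v.\<close>

lemma wL1_integrable_weight:
  fixes v :: "real ^ 'n \<Rightarrow> complex"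
  assumes v: "v \<in> wL1 \<gamma>" and g: "g \<in> borel_measurable borel"
    and "\<And>x. norm (g x) \<le> C * (1 + norm x) powr \<gamma>"
  shows "integrable lebesgue (\<lambda>x. g x * v x)"
proof (rule Bochner_Integration.integrable_bound)
  show "integrable lebesgue (\<lambda>x. C * ((1 + norm x) powr \<gamma> * norm (v x)))"
    using v by (auto simp: wL1_def)
  show "(\<lambda>x. g x * v x) \<in> borel_measurable lebesgue"
    using v g by (intro borel_measurable_times) (auto simp: wL1_def measurable_completion)
  show "AE x in lebesgue. norm (g x * v x) \<le> norm (C * ((1 + norm x) powr \<gamma> * norm (v x)))"
    using assms(3) order_trans[OF _ abs_ge_self]
    by (auto simp: norm_mult mult.assoc[symmetric] abs_mult[of _ "norm _"] simp del: abs_mult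
        intro!: AE_I2 mult_right_mono)
qed

lemma abs_prod_power_le_norm_power:
  fixes x :: "real ^ 'n"
  shows "\<bar>\<Prod>i\<in>UNIV. x $ i ^ \<alpha> i\<bar> \<le> norm x ^ (sum \<alpha> UNIV)"
  unfolding abs_prod power_sum power_abs
  by (intro prod_mono) (auto intro: power_mono component_le_norm_cart)

lemma norm_power_le_weight:
  fixes x :: "'a::real_normed_vector"
  assumes "real j \<le> \<gamma>"
  shows "norm x ^ j \<le> (1 + norm x) powr \<gamma>"
proof -
  have "norm x ^ j \<le> (1 + norm x) ^ j" by (intro power_mono) auto
  also have "\<dots> = (1 + norm x) powr real j" by (subst powr_realpow) (auto simp: add_pos_nonneg)
  also have "\<dots> \<le> (1 + norm x) powr \<gamma>" using assms by (intro powr_mono) auto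
  finally show ?thesis .
qed

text \<open>The multinomial theorem for the j-th power of -i(x . \<xi>), integrated against v. The
  sign and the factorials in \<open>moment\<close> are those of this expansion.\<close>

lemma sum_moment_eq:
  fixes v :: "real ^ 'n \<Rightarrow> complex"
  assumes v: "v \<in> wL1 \<gamma>" and j: "real j \<le> \<gamma>"
  shows "(\<Sum>\<alpha> | sum \<alpha> UNIV = j. moment \<alpha> v * (\<Prod>i\<in>UNIV. (\<i> * complex_of_real (\<xi> $ i)) ^ \<alpha> i)) =
    (LINT x|lebesgue. (\<i> * complex_of_real (- (x \<bullet> \<xi>))) ^ j / fact j * v x)"
proof -
  let ?p = "\<lambda>\<alpha> x :: real ^ 'n. complex_of_real (\<Prod>i\<in>UNIV. x $ i ^ \<alpha> i)"
  let ?c = "\<lambda>\<alpha>. (- 1) ^ (sum \<alpha> UNIV) / (\<Prod>i\<in>UNIV. fact (\<alpha> i)) *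
     (\<Prod>i\<in>UNIV. (\<i> * complex_of_real (\<xi> $ i)) ^ \<alpha> i)"
  have i: "integrable lebesgue (\<lambda>x. ?c \<alpha> * (?p \<alpha> x * v x))" if "sum \<alpha> UNIV = j" for \<alpha>
  proof (intro integrable_mult_right wL1_integrable_weight[OF v, where C = 1])
    show "cmod (?p \<alpha> x) \<le> 1 * (1 + norm x) powr \<gamma>" for x
      using order_trans[OF abs_prod_power_le_norm_power[of x \<alpha>], unfolded that, OF norm_power_le_weight[OF j]]
      by (simp only: norm_of_real mult_1)
  qed measurable
  have eq: "(\<Sum>\<alpha> | sum \<alpha> UNIV = j. ?c \<alpha> * (?p \<alpha> x * v x)) =
      (\<i> * complex_of_real (- (x \<bullet> \<xi>))) ^ j / fact j * v x" for x
  proof -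
    have "\<i> * complex_of_real (- (x \<bullet> \<xi>)) = (\<Sum>i\<in>UNIV. - complex_of_real (x $ i) * (\<i> * complex_of_real (\<xi> $ i)))"
      by (simp add: inner_vec_def sum_distrib_left sum_negf mult_ac)
    then have "(\<i> * complex_of_real (- (x \<bullet> \<xi>))) ^ j / fact j = (\<Sum>\<alpha> | sum \<alpha> UNIV = j.
        \<Prod>i\<in>UNIV. (- complex_of_real (x $ i) * (\<i> * complex_of_real (\<xi> $ i))) ^ \<alpha> i / fact (\<alpha> i))"
      by (simp only: multinomial_divided_power)
    also have "\<dots> = (\<Sum>\<alpha> | sum \<alpha> UNIV = j. ?c \<alpha> * ?p \<alpha> x)"
    proof (intro sum.cong refl)
      fix \<alpha> :: "'n \<Rightarrow> nat"
      have "(\<Prod>i\<in>UNIV. (- complex_of_real (x $ i)) ^ \<alpha> i) = (- 1) ^ (sum \<alpha> UNIV) * ?p \<alpha> x"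
        unfolding power_minus[of "complex_of_real _"] by (simp add: prod.distrib power_sum)
      then show "(\<Prod>i\<in>UNIV. (- complex_of_real (x $ i) * (\<i> * complex_of_real (\<xi> $ i))) ^ \<alpha> i / fact (\<alpha> i))
          = ?c \<alpha> * ?p \<alpha> x"
        by (simp only: prod.distrib prod_dividef power_mult_distrib times_divide_eq_left
              times_divide_eq_right mult_ac)
    qed
    finally show ?thesis
      by (simp only: sum_distrib_right mult.assoc)
  qed
  have "(\<Sum>\<alpha> | sum \<alpha> UNIV = j. moment \<alpha> v * (\<Prod>i\<in>UNIV. (\<i> * complex_of_real (\<xi> $ i)) ^ \<alpha> i)) =
      (\<Sum>\<alpha> | sum \<alpha> UNIV = j. LINT x|lebesgue. ?c \<alpha> * (?p \<alpha> x * v x))"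
    unfolding moment_def integral_mult_right_zero by (simp only: mult_ac)
  also have "\<dots> = (LINT x|lebesgue. (\<Sum>\<alpha> | sum \<alpha> UNIV = j. ?c \<alpha> * (?p \<alpha> x * v x)))"
    by (rule Bochner_Integration.integral_sum[symmetric]) (use i in auto)
  finally show ?thesis unfolding eq .
qed

section \<open>Taylor remainders of the character and of the transform\<close>

definition iexp_remainder :: "nat \<Rightarrow> real \<Rightarrow> complex" where
  "iexp_remainder m y = iexp y - (\<Sum>k\<le>m. (\<i> * y) ^ k / fact k)"

lemma borel_measurable_iexp_remainder [measurable]: "iexp_remainder m \<in> borel_measurable borel"
  unfolding iexp_remainder_def[abs_def] by measurable

lemma norm_iexp_remainder_le: "norm (iexp_remainder m y) \<le> \<bar>y\<bar> ^ Suc m"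
proof -
  have "norm (iexp_remainder m y) \<le> \<bar>y\<bar> ^ Suc m / fact (Suc m)"
    unfolding iexp_remainder_def by (rule iexp_approx1)
  also have "\<dots> \<le> \<bar>y\<bar> ^ Suc m / 1" by (intro divide_left_mono fact_ge_1) auto
  finally show ?thesis by simp
qed

text \<open>Interpolation between two integer orders: for |y| \<le> 1 the bound of order m + 1 is
  the better one, for |y| \<ge> 1 the bound of order m. At y = 0 the right side is 0 even for s = 0,
  but so is the remainder.\<close>

lemma norm_iexp_remainder_le_powr:
  assumes "real m \<le> s" "s \<le> real (Suc m)"
  shows "norm (iexp_remainder m y) \<le> 2 * \<bar>y\<bar> powr s"
proof -
  consider "y = 0" | "0 < \<bar>y\<bar>" "\<bar>y\<bar> \<le> 1" | "\<bar>y\<bar> \<ge> 1" by linarith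
  then show ?thesis
  proof cases
    case 1
    then show ?thesis using norm_iexp_remainder_le[of m y] by simp
  next
    case 2
    have "\<bar>y\<bar> ^ Suc m = \<bar>y\<bar> powr real (Suc m)" using 2 by (subst powr_realpow) auto
    also have "\<dots> \<le> \<bar>y\<bar> powr s" using 2 assms by (intro powr_mono') auto
    finally show ?thesis using norm_iexp_remainder_le[of m y] powr_ge_zero[of "\<bar>y\<bar>" s] by linarith
  next
    case 3
    have "norm (iexp_remainder m y) \<le> 2 * \<bar>y\<bar> ^ m / fact m"
      unfolding iexp_remainder_def by (rule iexp_approx2)
    also have "\<dots> \<le> 2 * \<bar>y\<bar> ^ m / 1" by (intro divide_left_mono fact_ge_1) auto
    also have "\<bar>y\<bar> ^ m = \<bar>y\<bar> powr real m" using 3 by (subst powr_realpow) auto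
    also have "\<dots> \<le> \<bar>y\<bar> powr s" using 3 assms by (intro powr_mono) auto
    finally show ?thesis by simp
  qed
qed

text \<open>For v with moments up to order m this is the Taylor polynomial at 0 of the transform of
  v.\<close>

definition moment_poly :: "nat \<Rightarrow> (real ^ 'n \<Rightarrow> complex) \<Rightarrow> real ^ 'n \<Rightarrow> complex" where
  "moment_poly m v \<xi> = (\<Sum>j\<le>m. \<Sum>\<alpha> | sum \<alpha> UNIV = j.
     moment \<alpha> v * (\<Prod>i\<in>UNIV. (\<i> * complex_of_real (\<xi> $ i)) ^ \<alpha> i))"

lemma borel_measurable_moment_poly [measurable]: "moment_poly m v \<in> borel_measurable borel"
  unfolding moment_poly_def[abs_def] by measurable

lemma wL1_integrable_inner_power:
  fixes v :: "real ^ 'n \<Rightarrow> complex"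
  assumes v: "v \<in> wL1 \<gamma>" and j: "real j \<le> \<gamma>"
  shows "integrable lebesgue (\<lambda>x. (\<i> * complex_of_real (- (x \<bullet> \<xi>))) ^ j / fact j * v x)"
proof (rule wL1_integrable_weight[OF v, where C = "norm \<xi> ^ j"])
  show "norm ((\<i> * complex_of_real (- (x \<bullet> \<xi>))) ^ j / fact j) \<le> norm \<xi> ^ j * (1 + norm x) powr \<gamma>" for x
  proof -
    have "norm ((\<i> * complex_of_real (- (x \<bullet> \<xi>))) ^ j / fact j) \<le> \<bar>x \<bullet> \<xi>\<bar> ^ j / 1"
      unfolding norm_divide norm_power norm_mult
      by (intro frac_le) (simp_all add: fact_ge_1)
    also have "\<dots> \<le> (norm \<xi> * norm x) ^ j"
      using Cauchy_Schwarz_ineq2[of x \<xi>] by (simp add: power_mono mult.commute)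
    also have "\<dots> \<le> norm \<xi> ^ j * (1 + norm x) powr \<gamma>"
      unfolding power_mult_distrib by (intro mult_left_mono norm_power_le_weight j) auto
    finally show ?thesis .
  qed
qed measurable

lemma fourier_minus_moment_poly:
  fixes v :: "real ^ 'n \<Rightarrow> complex"
  assumes v: "v \<in> wL1 \<gamma>" and m: "real m \<le> \<gamma>"
  shows "fourier v \<xi> - moment_poly m v \<xi> = (LINT x|lebesgue. iexp_remainder m (- (x \<bullet> \<xi>)) * v x)"
proof -
  have v': "integrable lebesgue v" using v by (simp add: wL1_def)
  let ?t = "\<lambda>j x. (\<i> * complex_of_real (- (x \<bullet> \<xi>))) ^ j / fact j * v x"
  have t: "integrable lebesgue (?t j)" if "j \<in> {..m}" for j
    using that m by (intro wL1_integrable_inner_power[OF v]) auto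
  have "moment_poly m v \<xi> = (\<Sum>j\<le>m. (LINT x|lebesgue. ?t j x))"
    unfolding moment_poly_def using m by (intro sum.cong refl sum_moment_eq[OF v]) auto
  also have "\<dots> = (LINT x|lebesgue. (\<Sum>j\<le>m. ?t j x))"
    by (rule Bochner_Integration.integral_sum[symmetric]) (rule t)
  finally have "fourier v \<xi> - moment_poly m v \<xi> =
      (LINT x|lebesgue. exp (- (\<i> * complex_of_real (x \<bullet> \<xi>))) * v x - (\<Sum>j\<le>m. ?t j x))"
    unfolding fourier_def
    by (subst Bochner_Integration.integral_diff[OF integrable_fourier_kernel[OF v'] Bochner_Integration.integrable_sum[OF t]])
       auto
  then show ?thesis
    by (simp add: iexp_remainder_def left_diff_distrib sum_distrib_right)
qed

text \<open>The exponent s is separate from \<gamma> because the coefficient of a^l is expanded only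
  to order s = \<gamma> - 2\<sigma>l, while the growth in x may use the full weight.\<close>

lemma norm_inner_remainder_le:
  fixes x \<xi> :: "real ^ 'n"
  assumes "0 \<le> s" "s \<le> \<gamma>" "real m \<le> s" "s \<le> real (Suc m)"
  shows "norm (iexp_remainder m (- (x \<bullet> \<xi>))) \<le> 2 * norm \<xi> powr s * (1 + norm x) powr \<gamma>"
proof -
  have "norm (iexp_remainder m (- (x \<bullet> \<xi>))) \<le> 2 * \<bar>- (x \<bullet> \<xi>)\<bar> powr s"
    using assms by (intro norm_iexp_remainder_le_powr)
  also have "\<bar>- (x \<bullet> \<xi>)\<bar> powr s \<le> (norm \<xi> * (1 + norm x)) powr s"
  proof (rule powr_mono2)
    have "\<bar>x \<bullet> \<xi>\<bar> \<le> norm \<xi> * norm x" using Cauchy_Schwarz_ineq2[of x \<xi>] by (simp add: mult.commute)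
    also have "\<dots> \<le> norm \<xi> * (1 + norm x)" by (intro mult_left_mono) auto
    finally show "\<bar>- (x \<bullet> \<xi>)\<bar> \<le> norm \<xi> * (1 + norm x)" by simp
  qed (use assms in auto)
  also have "\<dots> = norm \<xi> powr s * (1 + norm x) powr s" by (simp add: powr_mult)
  also have "\<dots> \<le> norm \<xi> powr s * (1 + norm x) powr \<gamma>"
    using assms by (intro mult_left_mono powr_mono) auto
  finally show ?thesis by simp
qed

lemma norm_fourier_minus_moment_poly_le:
  fixes v :: "real ^ 'n \<Rightarrow> complex"
  assumes v: "v \<in> wL1 \<gamma>" and s: "0 \<le> s" "s \<le> \<gamma>" "real m \<le> s" "s \<le> real (Suc m)"
  shows "norm (fourier v \<xi> - moment_poly m v \<xi>) \<le> 2 * norm \<xi> powr s * wL1_norm \<gamma> v"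
proof -
  have "norm (fourier v \<xi> - moment_poly m v \<xi>) \<le>
      (LINT x|lebesgue. 2 * norm \<xi> powr s * ((1 + norm x) powr \<gamma> * norm (v x)))"
    unfolding fourier_minus_moment_poly[OF v order_trans[OF s(3,2)]]
  proof (rule Bochner_Integration.integral_norm_bound_integral)
    show "integrable lebesgue (\<lambda>x. iexp_remainder m (- (x \<bullet> \<xi>)) * v x)"
      by (rule wL1_integrable_weight[OF v _ norm_inner_remainder_le[OF s]]) measurable
    show "integrable lebesgue (\<lambda>x. 2 * norm \<xi> powr s * ((1 + norm x) powr \<gamma> * norm (v x)))"
      using v by (auto simp: wL1_def)
    show "norm (iexp_remainder m (- (x \<bullet> \<xi>)) * v x) \<le> 2 * norm \<xi> powr s * ((1 + norm x) powr \<gamma> * norm (v x))" for x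
      using mult_right_mono[OF norm_inner_remainder_le[OF s, of x \<xi>] norm_ge_zero[of "v x"]]
      by (simp add: norm_mult mult.assoc)
  qed
  then show ?thesis by (simp add: wL1_norm_def)
qed

text \<open>Dominated convergence. The quotients are dominated by the weight times |v|, and for
  fixed x they are O(|\<xi>|^(m+1-s)), which vanishes in the limit because s < m + 1. The factor
  |x|^(m+1) occurs only for fixed x, so no moment of order m + 1 is involved.\<close>

lemma fourier_minus_moment_poly_tendsto:
  fixes v :: "real ^ 'n \<Rightarrow> complex"
  assumes v: "v \<in> wL1 \<gamma>" and s: "0 \<le> s" "s \<le> \<gamma>" "real m \<le> s" "s < real (Suc m)"
  shows "((\<lambda>\<xi>. norm (fourier v \<xi> - moment_poly m v \<xi>) / norm \<xi> powr s) \<longlongrightarrow> 0) (at 0)"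
  unfolding tendsto_at_iff_sequentially
proof (intro allI impI)
  fix X :: "nat \<Rightarrow> real ^ 'n" assume X: "\<forall>i. X i \<in> UNIV - {0}" "X \<longlonglongrightarrow> 0"
  let ?f = "\<lambda>i x. iexp_remainder m (- (x \<bullet> X i)) * v x / complex_of_real (norm (X i) powr s)"
  have vm [measurable]: "v \<in> borel_measurable lebesgue" using v by (auto simp: wL1_def)
  have nX: "norm (X i) > 0" for i using X(1) by auto
  have "(\<lambda>i. LINT x|lebesgue. ?f i x) \<longlonglongrightarrow> (LINT x|(lebesgue :: (real ^ 'n) measure). 0)"
  proof (rule integral_dominated_convergence)
    show "?f i \<in> borel_measurable lebesgue" for i
    proof -
      have "(\<lambda>x. iexp_remainder m (- (x \<bullet> X i))) \<in> borel_measurable borel" by measurable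
      note [measurable] = borel_measurable_lebesgue_comp[OF this]
      show ?thesis by measurable
    qed
    show "integrable lebesgue (\<lambda>x. 2 * ((1 + norm x) powr \<gamma> * norm (v x)))"
      using v by (auto simp: wL1_def)
    show "AE x in lebesgue. norm (?f i x) \<le> 2 * ((1 + norm x) powr \<gamma> * norm (v x))" for i
    proof (intro AE_I2)
      fix x
      have "norm (iexp_remainder m (- (x \<bullet> X i)) * v x) \<le> 2 * norm (X i) powr s * (1 + norm x) powr \<gamma> * norm (v x)"
        unfolding norm_mult using s by (intro mult_right_mono norm_inner_remainder_le) auto
      then show "norm (?f i x) \<le> 2 * ((1 + norm x) powr \<gamma> * norm (v x))"
        using nX[of i] by (simp add: norm_divide divide_le_eq mult_ac)
    qed
    show "AE x in lebesgue. (\<lambda>i. ?f i x) \<longlonglongrightarrow> 0"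
    proof (rule AE_I2)
      fix x
      let ?b = "\<lambda>i. norm x ^ Suc m * norm (X i) powr (real (Suc m) - s) * norm (v x)"
      have b: "norm (?f i x) \<le> ?b i" for i
      proof -
        have "norm (iexp_remainder m (- (x \<bullet> X i))) \<le> \<bar>- (x \<bullet> X i)\<bar> ^ Suc m"
          by (rule norm_iexp_remainder_le)
        also have "\<dots> \<le> (norm x * norm (X i)) ^ Suc m"
          using Cauchy_Schwarz_ineq2[of x "X i"] by (intro power_mono) simp_all
        also have "\<dots> = norm x ^ Suc m * (norm (X i) powr (real (Suc m) - s) * norm (X i) powr s)"
          using powr_realpow[OF nX[of i], of "Suc m"]
          unfolding power_mult_distrib powr_add[symmetric] by (simp only: diff_add_cancel)
        finally have "norm (iexp_remainder m (- (x \<bullet> X i))) / norm (X i) powr s \<le>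
            norm x ^ Suc m * norm (X i) powr (real (Suc m) - s)"
          using nX[of i] by (simp add: divide_le_eq mult.assoc del: power_Suc of_nat_Suc)
        from mult_right_mono[OF this norm_ge_zero[of "v x"]] show ?thesis
          by (simp add: norm_divide norm_mult del: power_Suc of_nat_Suc)
      qed
      have "(\<lambda>i. norm (X i) powr (real (Suc m) - s)) \<longlonglongrightarrow> 0 powr (real (Suc m) - s)"
        using tendsto_norm[OF X(2)] s by (intro tendsto_powr') (auto simp del: of_nat_Suc)
      from tendsto_mult_right[OF tendsto_mult_left[OF this, of "norm x ^ Suc m"], of "norm (v x)"]
      have "?b \<longlonglongrightarrow> 0" by (simp del: power_Suc)
      then show "(\<lambda>i. ?f i x) \<longlonglongrightarrow> 0"
        by (rule Lim_null_comparison[OF always_eventually[OF allI[OF b]]])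
    qed
  qed simp
  then have "(\<lambda>i. (fourier v (X i) - moment_poly m v (X i)) / complex_of_real (norm (X i) powr s)) \<longlonglongrightarrow> 0"
    unfolding fourier_minus_moment_poly[OF v order_trans[OF s(3,2)]] by simp
  from tendsto_norm[OF this]
  show "((\<lambda>\<xi>. norm (fourier v \<xi> - moment_poly m v \<xi>) / norm \<xi> powr s) \<circ> X) \<longlonglongrightarrow> 0"
    by (simp add: o_def norm_divide)
qed

section \<open>The exponents and the profile\<close>

lemma finite_exponent_pairs:
  assumes "\<sigma> \<ge> 1"
  shows "finite {(l :: nat, j :: nat). 2 * \<sigma> * real l + real j \<le> M}"
proof (rule finite_subset)
  show "{(l, j). 2 * \<sigma> * real l + real j \<le> M} \<subseteq> {..nat \<lfloor>M\<rfloor>} \<times> {..nat \<lfloor>M\<rfloor>}"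
  proof clarify
    fix l j assume le: "2 * \<sigma> * real l + real j \<le> M"
    have "1 * real l \<le> 2 * \<sigma> * real l" using assms by (intro mult_right_mono) auto
    then have "real l \<le> M" "real j \<le> M" using le assms by (auto intro: order_trans[rotated])
    then show "l \<in> {..nat \<lfloor>M\<rfloor>} \<and> j \<in> {..nat \<lfloor>M\<rfloor>}" by (simp add: le_nat_floor)
  qed
qed simp

text \<open>Only finitely many exponents lie below any bound, so \<open>LEAST\<close>, which on a
  set of reals need not be attained, is a genuine minimum here.\<close>

lemma exponents_Least:
  assumes "\<sigma> \<ge> 1" "A \<subseteq> exponents \<sigma>" "A \<noteq> {}"
  shows "(LEAST s. s \<in> A) \<in> A" and "s \<in> A \<Longrightarrow> (LEAST s. s \<in> A) \<le> s"
proof -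
  obtain a where a: "a \<in> A" using assms(3) by blast
  have "A \<inter> {..a} \<subseteq> (\<lambda>(l, j). 2 * \<sigma> * real l + real j) ` {(l, j). 2 * \<sigma> * real l + real j \<le> a}"
    using assms(2) by (auto simp: exponents_def image_iff)
  then have fin: "finite (A \<inter> {..a})"
    by (rule finite_surj[OF finite_exponent_pairs[OF assms(1)]])
  have ne: "A \<inter> {..a} \<noteq> {}" using a by auto
  let ?m = "Min (A \<inter> {..a})"
  have m: "?m \<in> A" "?m \<le> a" using Min_in[OF fin ne] by auto
  have le: "?m \<le> s" if "s \<in> A" for s
    using Min_le[OF fin, of s] that m by (cases "s \<le> a") auto
  have "(LEAST s. s \<in> A) = ?m" by (intro Least_equality m le)
  then show "(LEAST s. s \<in> A) \<in> A" "s \<in> A \<Longrightarrow> (LEAST s. s \<in> A) \<le> s" using m le by auto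
qed

lemma infinite_exponents: "infinite (exponents \<sigma>)"
proof -
  have "range real \<subseteq> exponents \<sigma>"
    unfolding exponents_def by (auto intro: exI[of _ 0])
  moreover have "infinite (range real)" by (simp add: finite_image_iff)
  ultimately show ?thesis by (rule infinite_super)
qed

lemma
  assumes "\<sigma> \<ge> 1"
  shows lambda_seq_mem: "lambda_seq \<sigma> k \<in> exponents \<sigma> - lambda_seq \<sigma> ` {..<k}"
    and lambda_seq_le: "s \<in> exponents \<sigma> - lambda_seq \<sigma> ` {..<k} \<Longrightarrow> lambda_seq \<sigma> k \<le> s"
proof -
  have "exponents \<sigma> - lambda_seq \<sigma> ` {..<k} \<noteq> {}"
    using infinite_exponents[of \<sigma>] finite_subset[of "exponents \<sigma>" "lambda_seq \<sigma> ` {..<k}"] by auto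
  note L = exponents_Least[OF assms Diff_subset this, folded lambda_seq.simps[of \<sigma> k]]
  show "lambda_seq \<sigma> k \<in> exponents \<sigma> - lambda_seq \<sigma> ` {..<k}" by (rule L)
  show "s \<in> exponents \<sigma> - lambda_seq \<sigma> ` {..<k} \<Longrightarrow> lambda_seq \<sigma> k \<le> s" by (rule L)
qed

text \<open>No exponent lies strictly between two consecutive values of the enumeration. This
  replaces \<lambda>(k) by \<gamma> in the index set of the profile.\<close>

lemma exponent_le_lambda_seq_iff:
  assumes "\<sigma> \<ge> 1" "lambda_seq \<sigma> k \<le> \<gamma>" "\<gamma> < lambda_seq \<sigma> (Suc k)" "s \<in> exponents \<sigma>"
  shows "s \<le> lambda_seq \<sigma> k \<longleftrightarrow> s \<le> \<gamma>"
proof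
  assume "s \<le> \<gamma>"
  \<comment> \<open>Were s not yet enumerated, minimality of \<lambda>(k+1) would force
    \<lambda>(k+1) \<le> s \<le> \<gamma>.\<close>
  then have "s \<in> lambda_seq \<sigma> ` {..<Suc k}"
    using lambda_seq_le[OF assms(1), of s "Suc k"] assms(3,4) by (cases "s \<in> lambda_seq \<sigma> ` {..<Suc k}") auto
  then obtain j where "j \<le> k" "s = lambda_seq \<sigma> j"
    by (auto simp: less_Suc_eq_le)
  \<comment> \<open>At stage j the value \<lambda>(k) was still available, so minimality of
    \<lambda>(j) gives \<lambda>(j) \<le> \<lambda>(k).\<close>
  moreover have "lambda_seq \<sigma> k \<in> exponents \<sigma> - lambda_seq \<sigma> ` {..<j}"
    using lambda_seq_mem[OF assms(1), of k] \<open>j \<le> k\<close> by auto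
  ultimately show "s \<le> lambda_seq \<sigma> k" using lambda_seq_le[OF assms(1)] by simp
qed (use assms(2) in simp)

lemma le_nat_floor_iff:
  fixes x :: real
  assumes "x \<ge> 0"
  shows "n \<le> nat \<lfloor>x\<rfloor> \<longleftrightarrow> real n \<le> x"
  using assms by (metis le_nat_floor of_nat_floor of_nat_le_iff order_trans)

text \<open>Grouping by l exhibits the profile as a truncated geometric series in \<open>a\<close>
  whose coefficients are Taylor polynomials of the transform, of decreasing order.\<close>

lemma profile_eq_moment_poly:
  assumes "\<sigma> \<ge> 1" "\<gamma> \<ge> 0" "lambda_seq \<sigma> k \<le> \<gamma>" "\<gamma> < lambda_seq \<sigma> (Suc k)"
  shows "profile \<sigma> k v \<xi> = (\<Sum>l<Suc (nat \<lfloor>\<gamma> / (2 * \<sigma>)\<rfloor>).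
    complex_of_real ((norm \<xi> powr (2 * \<sigma>)) ^ l) * moment_poly (nat \<lfloor>\<gamma> - 2 * \<sigma> * real l\<rfloor>) v \<xi>)"
proof -
  let ?N = "Suc (nat \<lfloor>\<gamma> / (2 * \<sigma>)\<rfloor>)" and ?m = "\<lambda>l. nat \<lfloor>\<gamma> - 2 * \<sigma> * real l\<rfloor>"
  have "{(l, j). 2 * \<sigma> * real l + real j \<le> lambda_seq \<sigma> k} = (SIGMA l:{..<?N}. {..?m l})"
  proof (intro set_eqI)
    fix p :: "nat \<times> nat"
    obtain l j where p: "p = (l, j)" by fastforce
    have "2 * \<sigma> * real l + real j \<in> exponents \<sigma>" by (auto simp: exponents_def)
    then have "2 * \<sigma> * real l + real j \<le> lambda_seq \<sigma> k \<longleftrightarrow> 2 * \<sigma> * real l + real j \<le> \<gamma>"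
      by (rule exponent_le_lambda_seq_iff[OF assms(1,3,4)])
    \<comment> \<open>The first conjunct follows from the second but must be kept: for larger l the
      conversion by \<open>nat\<close> would turn a negative order into 0 and admit j = 0.\<close>
    also have "\<dots> \<longleftrightarrow> 2 * \<sigma> * real l \<le> \<gamma> \<and> real j \<le> \<gamma> - 2 * \<sigma> * real l"
      by auto
    also have "2 * \<sigma> * real l \<le> \<gamma> \<longleftrightarrow> l < ?N"
      using assms(1,2) by (simp add: less_Suc_eq_le le_nat_floor_iff field_simps)
    also have "l < ?N \<and> real j \<le> \<gamma> - 2 * \<sigma> * real l \<longleftrightarrow> l < ?N \<and> j \<le> ?m l"
      using \<open>2 * \<sigma> * real l \<le> \<gamma> \<longleftrightarrow> l < ?N\<close> by (auto simp: le_nat_floor_iff)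
    finally show "p \<in> {(l, j). 2 * \<sigma> * real l + real j \<le> lambda_seq \<sigma> k} \<longleftrightarrow>
        p \<in> (SIGMA l:{..<?N}. {..?m l})"
      by (simp add: p)
  qed
  then show ?thesis
    unfolding profile_def moment_poly_def sum_distrib_left by (subst sum.Sigma) auto
qed

section \<open>The residual and the pointwise error bound\<close>

lemma L1_le_wL1_norm:
  fixes v :: "real ^ 'n \<Rightarrow> complex"
  assumes "v \<in> wL1 \<gamma>" "\<gamma> \<ge> 0"
  shows "(LINT x|lebesgue. norm (v x)) \<le> wL1_norm \<gamma> v"
  unfolding wL1_norm_def
proof (rule integral_mono)
  show "norm (v x) \<le> (1 + norm x) powr \<gamma> * norm (v x)" for x
    using mult_right_mono[OF ge_one_powr_ge_zero[of "1 + norm x" \<gamma>] norm_ge_zero[of "v x"]] assms by simp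
qed (use assms in \<open>auto simp: wL1_def\<close>)

lemma wL1_norm_nonneg: "wL1_norm \<gamma> v \<ge> 0"
  unfolding wL1_norm_def by (rule integral_nonneg_AE) auto

lemma wL1_add:
  fixes u v :: "real ^ 'n \<Rightarrow> complex"
  assumes u: "u \<in> wL1 \<gamma>" and v: "v \<in> wL1 \<gamma>"
  shows "(\<lambda>x. u x + v x) \<in> wL1 \<gamma>"
proof -
  have "(\<lambda>x::real^'n. complex_of_real ((1 + norm x) powr \<gamma>)) \<in> borel_measurable borel" by measurable
  then have *: "integrable lebesgue (\<lambda>x. complex_of_real ((1 + norm x) powr \<gamma>) * w x)" if "w \<in> wL1 \<gamma>" for w
    using wL1_integrable_weight[OF that, where C = 1] by simp
  show ?thesis
    using u v integrable_norm[OF Bochner_Integration.integrable_add[OF *[OF u] *[OF v]]]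
    by (simp add: wL1_def norm_mult flip: distrib_left)
qed

lemma fourier_add:
  fixes u v :: "real ^ 'n \<Rightarrow> complex"
  assumes "integrable lebesgue u" "integrable lebesgue v"
  shows "fourier (\<lambda>x. u x + v x) \<xi> = fourier u \<xi> + fourier v \<xi>"
  unfolding fourier_def distrib_left
  by (rule Bochner_Integration.integral_add; rule integrable_fourier_kernel; fact)

text \<open>The coefficient of \<open>e\<^sup>-\<^sup>t\<^sup>a\<close> in the error; for \<open>a \<ge> 1/2\<close> the solution itself decays
  exponentially, so only the profile is left. Bounds by \<open>norm \<xi> powr \<gamma>\<close> exclude \<open>\<xi> = 0\<close>, since
  \<open>0 powr 0 = 0\<close>.\<close>

definition residual :: "real \<Rightarrow> nat \<Rightarrow> (real ^ 'n \<Rightarrow> complex) \<Rightarrow> real ^ 'n \<Rightarrow> complex" where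
  "residual \<sigma> k v \<xi> = (if norm \<xi> powr (2 * \<sigma>) < 1 / 2
     then fourier v \<xi> / complex_of_real (1 - norm \<xi> powr (2 * \<sigma>)) - profile \<sigma> k v \<xi>
     else profile \<sigma> k v \<xi>)"

lemma borel_measurable_profile [measurable]: "profile \<sigma> k v \<in> borel_measurable borel"
  unfolding profile_def[abs_def] case_prod_beta by measurable

lemma borel_measurable_residual:
  fixes v :: "real ^ 'n \<Rightarrow> complex"
  assumes "integrable lebesgue v"
  shows "residual \<sigma> k v \<in> borel_measurable lebesgue"
proof -
  have "(\<lambda>\<xi>::real^'n. complex_of_real (1 - norm \<xi> powr (2 * \<sigma>))) \<in> borel_measurable borel" by measurable
  note [measurable] = borel_measurable_lebesgue_comp[OF this] borel_measurable_fourier[OF assms]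
    borel_measurable_lebesgue_comp[OF borel_measurable_profile]
  have "{\<xi>::real^'n. norm \<xi> powr (2 * \<sigma>) < 1 / 2} \<in> sets borel" by measurable
  then have [measurable]: "Measurable.pred lebesgue (\<lambda>\<xi>::real^'n. norm \<xi> powr (2 * \<sigma>) < 1 / 2)"
    by (auto simp: pred_def)
  show ?thesis unfolding residual_def[abs_def] by measurable
qed

context
  fixes \<sigma> \<gamma> :: real and k :: nat and v :: "real ^ 'n \<Rightarrow> complex" and N :: nat and m :: "nat \<Rightarrow> nat"
  assumes sg: "\<sigma> \<ge> 1" "\<gamma> \<ge> 0" "lambda_seq \<sigma> k \<le> \<gamma>" "\<gamma> < lambda_seq \<sigma> (Suc k)"
    and v: "v \<in> wL1 \<gamma>"
  defines "N \<equiv> Suc (nat \<lfloor>\<gamma> / (2 * \<sigma>)\<rfloor>)" and "m \<equiv> \<lambda>l. nat \<lfloor>\<gamma> - 2 * \<sigma> * real l\<rfloor>"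
begin

text \<open>In particular 2\<sigma>N > \<gamma>, so the tail a^N of the geometric series is of
  smaller order than |\<xi>|^\<gamma> at 0.\<close>

lemma less_N_iff: "l < N \<longleftrightarrow> 2 * \<sigma> * real l \<le> \<gamma>"
  using sg(1,2) by (simp add: N_def less_Suc_eq_le le_nat_floor_iff field_simps)

lemma order_bounds:
  assumes "l < N"
  shows "0 \<le> \<gamma> - 2 * \<sigma> * real l" "\<gamma> - 2 * \<sigma> * real l \<le> \<gamma>"
    "real (m l) \<le> \<gamma> - 2 * \<sigma> * real l" "\<gamma> - 2 * \<sigma> * real l < real (Suc (m l))"
proof -
  show *: "0 \<le> \<gamma> - 2 * \<sigma> * real l" "\<gamma> - 2 * \<sigma> * real l \<le> \<gamma>"
    using assms sg(1) by (auto simp: less_N_iff)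
  show "real (m l) \<le> \<gamma> - 2 * \<sigma> * real l" "\<gamma> - 2 * \<sigma> * real l < real (Suc (m l))"
    using * unfolding m_def by linarith+
qed

lemma powr_power_mult:
  fixes \<xi> :: "real ^ 'n"
  assumes "\<xi> \<noteq> 0"
  shows "(norm \<xi> powr (2 * \<sigma>)) ^ l = norm \<xi> powr (2 * \<sigma> * real l)"
  using assms by (simp add: powr_powr flip: powr_realpow)

text \<open>From 1/(1 - a) = (sum of a^l over l < N) + a^N/(1 - a), subtracting the profile leaves a
  Taylor remainder in each coefficient; 1 - a > 1/2 gives the factor 2 of the tail. Dividing by
  |\<xi>|^\<gamma> turns a^l into the lower exponent \<gamma> - 2\<sigma>l. The quotient form serves
  both the global bound and the limit at 0.\<close>

lemma norm_residual_low:
  assumes "\<xi> \<noteq> 0" and a: "norm \<xi> powr (2 * \<sigma>) < 1 / 2"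
  shows "norm (residual \<sigma> k v \<xi>) / norm \<xi> powr \<gamma> \<le>
    (\<Sum>l<N. norm (fourier v \<xi> - moment_poly (m l) v \<xi>) / norm \<xi> powr (\<gamma> - 2 * \<sigma> * real l)) +
    2 * norm \<xi> powr (2 * \<sigma> * real N - \<gamma>) * wL1_norm \<gamma> v"
proof -
  define a where "a = norm \<xi> powr (2 * \<sigma>)"
  let ?F = "fourier v \<xi>"
  have a: "0 \<le> a" "a < 1 / 2" using assms by (auto simp: a_def)
  have n: "norm \<xi> > 0" using assms by simp
  have "residual \<sigma> k v \<xi> = ?F / complex_of_real (1 - a) - profile \<sigma> k v \<xi>"
    using a by (simp add: residual_def a_def)
  also have "\<dots> = (\<Sum>l<N. complex_of_real (a ^ l) * (?F - moment_poly (m l) v \<xi>)) +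
      complex_of_real (a ^ N / (1 - a)) * ?F"
  proof -
    have "(1 - a ^ N) / (1 - a) = (\<Sum>l<N. a ^ l)"
      using a by (simp add: sum_gp_strict)
    then have "1 / (1 - a) = (\<Sum>l<N. a ^ l) + a ^ N / (1 - a)"
      by (simp add: diff_divide_distrib)
    then have "complex_of_real (1 / (1 - a)) * ?F =
        complex_of_real ((\<Sum>l<N. a ^ l) + a ^ N / (1 - a)) * ?F" by (simp only:)
    then have "?F / complex_of_real (1 - a) =
        (\<Sum>l<N. complex_of_real (a ^ l) * ?F) + complex_of_real (a ^ N / (1 - a)) * ?F"
      by (simp add: distrib_right sum_distrib_right)
    then show ?thesis
      unfolding profile_eq_moment_poly[OF sg] by (simp add: N_def m_def a_def right_diff_distrib sum_subtractf)
  qed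
  finally have "norm (residual \<sigma> k v \<xi>) \<le> (\<Sum>l<N. norm (complex_of_real (a ^ l) * (?F - moment_poly (m l) v \<xi>))) +
      norm (complex_of_real (a ^ N / (1 - a)) * ?F)"
    by (simp only:) (intro order_trans[OF norm_triangle_ineq] add_mono norm_sum order_refl)
  also have "norm (complex_of_real (a ^ N / (1 - a)) * ?F) \<le> 2 * a ^ N * wL1_norm \<gamma> v"
  proof -
    have "a ^ N / (1 - a) \<le> a ^ N / (1 / 2)" using a by (intro divide_left_mono) auto
    moreover have "norm ?F \<le> wL1_norm \<gamma> v"
      using norm_fourier_le[of v \<xi>] L1_le_wL1_norm[OF v sg(2)] v by (auto simp: wL1_def)
    ultimately have "(a ^ N / (1 - a)) * norm ?F \<le> (2 * a ^ N) * wL1_norm \<gamma> v"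
      using a by (intro mult_mono) auto
    then show ?thesis using a by (simp only: norm_mult norm_of_real abs_of_nonneg zero_le_power divide_nonneg_nonneg)
  qed
  also have "(\<Sum>l<N. norm (complex_of_real (a ^ l) * (?F - moment_poly (m l) v \<xi>))) =
     (\<Sum>l<N. a ^ l * norm (?F - moment_poly (m l) v \<xi>))"
    using a by (simp add: norm_mult norm_power)
  finally have "norm (residual \<sigma> k v \<xi>) / norm \<xi> powr \<gamma> \<le>
     ((\<Sum>l<N. a ^ l * norm (?F - moment_poly (m l) v \<xi>)) + 2 * a ^ N * wL1_norm \<gamma> v) / norm \<xi> powr \<gamma>"
    by (intro divide_right_mono) auto
  also have "\<dots> = (\<Sum>l<N. norm (?F - moment_poly (m l) v \<xi>) / norm \<xi> powr (\<gamma> - 2 * \<sigma> * real l)) +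
    2 * norm \<xi> powr (2 * \<sigma> * real N - \<gamma>) * wL1_norm \<gamma> v"
    using n unfolding a_def powr_power_mult[OF assms(1)] powr_diff add_divide_distrib sum_divide_distrib
    by (simp add: field_simps)
  finally show ?thesis .
qed

text \<open>At \<xi> = 0 the denominator vanishes and the quotient is 0 by convention.\<close>

lemma remainder_quotient_le:
  assumes "l < N"
  shows "norm (fourier v \<xi> - moment_poly (m l) v \<xi>) / norm \<xi> powr (\<gamma> - 2 * \<sigma> * real l) \<le> 2 * wL1_norm \<gamma> v"
  using norm_fourier_minus_moment_poly_le[OF v order_bounds(1-3)[OF assms] less_imp_le[OF order_bounds(4)[OF assms]], of \<xi>]
    wL1_norm_nonneg[of \<gamma> v]
  by (cases "\<xi> = 0") (auto simp: divide_le_eq mult_ac)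

text \<open>For a < 1/2 there are N Taylor quotients and one tail, each at most twice the norm,
  which gives 2N + 2. For a \<ge> 1/2 each of the N terms of the profile costs
  \<open>2 powr \<gamma> + 2\<close>. The constant covers both cases.\<close>

lemma norm_residual_le:
  assumes "\<xi> \<noteq> 0"
  shows "norm (residual \<sigma> k v \<xi>) \<le> (2 * real N + 2 + real N * 2 powr \<gamma>) * wL1_norm \<gamma> v * norm \<xi> powr \<gamma>"
proof (cases "norm \<xi> powr (2 * \<sigma>) < 1 / 2")
  case True
  have n: "norm \<xi> > 0" using assms by simp
  have "norm \<xi> \<le> 1"
  proof (rule ccontr)
    assume "\<not> norm \<xi> \<le> 1"
    then have "1 \<le> norm \<xi> powr (2 * \<sigma>)" using sg(1) by (intro ge_one_powr_ge_zero) auto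
    with True show False by simp
  qed
  moreover have "2 * \<sigma> * real N - \<gamma> \<ge> 0" using less_N_iff[of N] by simp
  ultimately have "norm \<xi> powr (2 * \<sigma> * real N - \<gamma>) \<le> 1" using n by (intro powr_le1) auto
  then have "2 * norm \<xi> powr (2 * \<sigma> * real N - \<gamma>) * wL1_norm \<gamma> v \<le> 2 * 1 * wL1_norm \<gamma> v"
    using wL1_norm_nonneg[of \<gamma> v] by (intro mult_right_mono mult_left_mono) auto
  moreover have "(\<Sum>l<N. norm (fourier v \<xi> - moment_poly (m l) v \<xi>) / norm \<xi> powr (\<gamma> - 2 * \<sigma> * real l))
      \<le> (\<Sum>l<N. 2 * wL1_norm \<gamma> v)"
    by (intro sum_mono remainder_quotient_le) auto
  ultimately have "norm (residual \<sigma> k v \<xi>) / norm \<xi> powr \<gamma> \<le> 2 * real N * wL1_norm \<gamma> v + 2 * wL1_norm \<gamma> v"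
    using norm_residual_low[OF assms True] by simp
  also have "\<dots> \<le> (2 * real N + 2 + real N * 2 powr \<gamma>) * wL1_norm \<gamma> v"
    using wL1_norm_nonneg[of \<gamma> v] by (simp add: distrib_right)
  finally show ?thesis using n by (simp add: divide_le_eq)
next
  case False
  define a where "a = norm \<xi> powr (2 * \<sigma>)"
  have n: "norm \<xi> > 0" using assms by simp
  have half: "norm \<xi> \<ge> 1 / 2"
  proof (rule ccontr)
    assume *: "\<not> 1 / 2 \<le> norm \<xi>"
    have "norm \<xi> powr (2 * \<sigma>) \<le> norm \<xi> powr 1" using * n sg(1) by (intro powr_mono') auto
    with * False n show False by simp
  qed
  have "norm (residual \<sigma> k v \<xi>) = norm (\<Sum>l<N. complex_of_real (a ^ l) * moment_poly (m l) v \<xi>)"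
    using False unfolding residual_def profile_eq_moment_poly[OF sg] by (simp add: N_def m_def a_def)
  also have "\<dots> \<le> (\<Sum>l<N. norm (complex_of_real (a ^ l) * moment_poly (m l) v \<xi>))"
    by (rule norm_sum)
  also have "\<dots> \<le> (\<Sum>l<N. (2 powr \<gamma> + 2) * wL1_norm \<gamma> v * norm \<xi> powr \<gamma>)"
  proof (intro sum_mono)
    fix l assume "l \<in> {..<N}"
    then have l: "l < N" by simp
    have al: "a ^ l = norm \<xi> powr (2 * \<sigma> * real l)" unfolding a_def by (rule powr_power_mult[OF assms])
    \<comment> \<open>The moment polynomial is controlled by the transform and the Taylor remainder,
      so no moment has to be estimated separately.\<close>
    have "norm (moment_poly (m l) v \<xi>) \<le> norm (fourier v \<xi>) + norm (fourier v \<xi> - moment_poly (m l) v \<xi>)"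
      using norm_triangle_ineq4[of "fourier v \<xi>" "fourier v \<xi> - moment_poly (m l) v \<xi>"] by simp
    also have "\<dots> \<le> wL1_norm \<gamma> v + 2 * wL1_norm \<gamma> v * norm \<xi> powr (\<gamma> - 2 * \<sigma> * real l)"
      using norm_fourier_le[of v \<xi>] L1_le_wL1_norm[OF v sg(2)] v remainder_quotient_le[OF l, of \<xi>] n
      by (intro add_mono) (auto simp: wL1_def divide_le_eq)
    finally have "norm (complex_of_real (a ^ l) * moment_poly (m l) v \<xi>) \<le>
        a ^ l * (wL1_norm \<gamma> v + 2 * wL1_norm \<gamma> v * norm \<xi> powr (\<gamma> - 2 * \<sigma> * real l))"
      unfolding norm_mult al by (simp add: mult_left_mono)
    also have "\<dots> = (norm \<xi> powr (2 * \<sigma> * real l) + 2 * norm \<xi> powr \<gamma>) * wL1_norm \<gamma> v"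
      using n unfolding al powr_diff by (simp add: field_simps)
    \<comment> \<open>Since 2|\<xi>| \<ge> 1, a factor
      \<open>(2 * norm \<xi>) powr (\<gamma> - 2 * \<sigma> * real l)\<close> raises the exponent to
      \<gamma> at the cost of at most \<open>2 powr \<gamma>\<close>.\<close>
    also have "norm \<xi> powr (2 * \<sigma> * real l) \<le> 2 powr \<gamma> * norm \<xi> powr \<gamma>"
    proof -
      have "norm \<xi> powr (2 * \<sigma> * real l) * 1 \<le> norm \<xi> powr (2 * \<sigma> * real l) * (2 * norm \<xi>) powr (\<gamma> - 2 * \<sigma> * real l)"
        using half order_bounds(1)[OF l] by (intro mult_left_mono ge_one_powr_ge_zero) auto
      also have "\<dots> = 2 powr (\<gamma> - 2 * \<sigma> * real l) * norm \<xi> powr \<gamma>"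
        using n by (simp add: powr_mult powr_diff)
      also have "\<dots> \<le> 2 powr \<gamma> * norm \<xi> powr \<gamma>"
        using order_bounds(2)[OF l] by (intro mult_right_mono powr_mono) auto
      finally show ?thesis by simp
    qed
    finally show "norm (complex_of_real (a ^ l) * moment_poly (m l) v \<xi>) \<le> (2 powr \<gamma> + 2) * wL1_norm \<gamma> v * norm \<xi> powr \<gamma>"
      using wL1_norm_nonneg[of \<gamma> v] by (simp add: mult_right_mono algebra_simps)
  qed
  also have "\<dots> = (2 * real N + 0 + real N * 2 powr \<gamma>) * wL1_norm \<gamma> v * norm \<xi> powr \<gamma>"
    by (simp add: algebra_simps)
  also have "\<dots> \<le> (2 * real N + 2 + real N * 2 powr \<gamma>) * wL1_norm \<gamma> v * norm \<xi> powr \<gamma>"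
    using wL1_norm_nonneg[of \<gamma> v] by (intro mult_right_mono) auto
  finally show ?thesis .
qed

text \<open>Both strict inequalities enter: each Taylor order exceeds its exponent after adding 1,
  and 2\<sigma>N > \<gamma> for the tail.\<close>

lemma residual_tendsto:
  "((\<lambda>\<xi>. norm (residual \<sigma> k v \<xi>) / norm \<xi> powr \<gamma>) \<longlongrightarrow> 0) (at 0)"
proof (rule Lim_null_comparison)
  let ?g = "\<lambda>\<xi>. (\<Sum>l<N. norm (fourier v \<xi> - moment_poly (m l) v \<xi>) / norm \<xi> powr (\<gamma> - 2 * \<sigma> * real l)) +
    2 * norm \<xi> powr (2 * \<sigma> * real N - \<gamma>) * wL1_norm \<gamma> v"
  have a: "((\<lambda>\<xi>::real^'n. norm \<xi> powr s) \<longlongrightarrow> 0) (at 0)" if "s > 0" for s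
  proof -
    have "((\<lambda>\<xi>::real^'n. norm \<xi> powr s) \<longlongrightarrow> 0 powr s) (at 0)"
      using that tendsto_norm[OF tendsto_ident_at[of "0::real^'n"]] by (intro tendsto_powr') auto
    then show ?thesis by simp
  qed
  have "\<forall>\<^sub>F \<xi>::real^'n in at 0. norm \<xi> powr (2 * \<sigma>) < 1 / 2"
    using sg(1) by (intro order_tendstoD(2)[OF a]) auto
  then show "\<forall>\<^sub>F \<xi> in at 0. norm (norm (residual \<sigma> k v \<xi>) / norm \<xi> powr \<gamma>) \<le> ?g \<xi>"
    using eventually_neq_at_within[of 0 0 UNIV]
    by eventually_elim (use norm_residual_low in auto)
  have "((\<lambda>\<xi>. norm (fourier v \<xi> - moment_poly (m l) v \<xi>) / norm \<xi> powr (\<gamma> - 2 * \<sigma> * real l)) \<longlongrightarrow> 0) (at 0)"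
    if "l \<in> {..<N}" for l
    using fourier_minus_moment_poly_tendsto[OF v order_bounds[of l]] that by simp
  moreover have "2 * \<sigma> * real N - \<gamma> > 0" using less_N_iff[of N] by simp
  ultimately have "(?g \<longlongrightarrow> (\<Sum>l<N. 0) + 2 * 0 * wL1_norm \<gamma> v) (at 0)"
    by (intro tendsto_intros a)
  then show "(?g \<longlongrightarrow> 0) (at 0)" by simp
qed

end

text \<open>The integral form decreases in \<open>a\<close> and has no singularity at
  \<open>a = 1\<close>, so the worst case is \<open>a = 1/2\<close>, where the quotient is
  explicit.\<close>

lemma kernel1_half_bound:
  assumes "t \<ge> 0" "a \<ge> 1 / 2"
  shows "\<bar>kernel1 t a\<bar> \<le> 2 * exp (- t / 2)"
proof -
  have i: "(\<lambda>s. exp (- s * (a - 1))) integrable_on {0..t}" for a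
    by (intro integrable_continuous_real continuous_intros)
  have "0 \<le> integral {0..t} (\<lambda>s. exp (- s * (a - 1)))"
    by (intro integral_nonneg i) auto
  then have "0 \<le> kernel1 t a" unfolding kernel1_eq_integral[OF assms(1)] by simp
  moreover have "integral {0..t} (\<lambda>s. exp (- s * (a - 1))) \<le> integral {0..t} (\<lambda>s. exp (- s * (1 / 2 - 1)))"
  proof (intro integral_le i)
    fix s assume "s \<in> {0..t}"
    then have "s * (1 / 2 - 1) \<le> s * (a - 1)" using assms(2) by (intro mult_left_mono) auto
    then show "exp (- s * (a - 1)) \<le> exp (- s * (1 / 2 - 1))" by simp
  qed
  then have "kernel1 t a \<le> kernel1 t (1 / 2)" unfolding kernel1_eq_integral[OF assms(1)] by simp
  moreover have "kernel1 t (1 / 2) \<le> 2 * exp (- t / 2)" by (simp add: kernel1_def)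
  ultimately show ?thesis by simp
qed

text \<open>Since \<open>kernel0\<close> is exp(-t) plus \<open>kernel1\<close>, the solution is
  exp(-t) times the transform of u0 plus \<open>kernel1\<close> times that of v. For a < 1/2 the
  part exp(-ta)/(1 - a) of \<open>kernel1\<close> goes into the residual and the other part is at
  most 2 exp(-t); for a \<ge> 1/2 all of \<open>kernel1\<close> is error, which dictates the rate
  exp(-t/2).\<close>

lemma norm_asymp_error_le:
  fixes u0 u1 :: "real ^ 'n \<Rightarrow> complex"
  assumes u: "integrable lebesgue u0" "integrable lebesgue u1" and t: "t \<ge> 0"
  defines "v \<equiv> \<lambda>x. u0 x + u1 x"
  shows "norm (asymp_error \<sigma> k u0 u1 t \<xi>) \<le> exp (- t * norm \<xi> powr (2 * \<sigma>)) * norm (residual \<sigma> k v \<xi>) +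
    2 * exp (- t / 2) * (norm (fourier u0 \<xi>) + norm (fourier v \<xi>))"
proof -
  define a where "a = norm \<xi> powr (2 * \<sigma>)"
  let ?c = complex_of_real
  let ?P = "profile \<sigma> k v \<xi>" and ?e = "?c (exp (- t * a))" and ?F = "fourier v \<xi>" and ?G = "fourier u0 \<xi>"
  have F: "?F = ?G + fourier u1 \<xi>" unfolding v_def by (rule fourier_add[OF u])
  have err: "asymp_error \<sigma> k u0 u1 t \<xi> = ?c (exp (- t)) * ?G + ?c (kernel1 t a) * ?F - ?P * ?e"
    unfolding asymp_error_def solution_hat_def kernel0_eq v_def[symmetric] F a_def[symmetric]
    by (simp add: algebra_simps)
  have et: "exp (- t) \<le> exp (- t / 2)" using t by simp
  show ?thesis
  proof (cases "a < 1 / 2")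
    case True
    have k: "kernel1 t a = (exp (- t * a) - exp (- t)) / (1 - a)" using True by (simp add: kernel1_def)
    have "asymp_error \<sigma> k u0 u1 t \<xi> = ?e * residual \<sigma> k v \<xi> + (?c (exp (- t)) * ?G - ?c (exp (- t) / (1 - a)) * ?F)"
      using True unfolding err k residual_def a_def[symmetric]
      by (simp add: diff_divide_distrib algebra_simps)
    also have "norm \<dots> \<le> norm (?e * residual \<sigma> k v \<xi>) + (norm (?c (exp (- t)) * ?G) + norm (?c (exp (- t) / (1 - a)) * ?F))"
      by (intro order_trans[OF norm_triangle_ineq] add_left_mono norm_triangle_ineq4)
    also have "\<dots> = exp (- t * a) * norm (residual \<sigma> k v \<xi>) + (exp (- t) * norm ?G + exp (- t) / (1 - a) * norm ?F)"
      using True by (simp add: norm_mult del: of_real_divide of_real_diff)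
    also have "exp (- t) / (1 - a) \<le> exp (- t) / (1 / 2)" using True by (intro divide_left_mono) auto
    also have "exp (- t) * norm ?G + exp (- t) / (1 / 2) * norm ?F \<le>
        2 * exp (- t / 2) * norm ?G + 2 * exp (- t / 2) * norm ?F"
      using et by (intro add_mono mult_right_mono) (auto intro: order_trans[of _ "2 * exp (- t)"])
    finally show ?thesis by (simp add: a_def algebra_simps mult_right_mono add_mono)
  next
    case False
    have "norm (asymp_error \<sigma> k u0 u1 t \<xi>) \<le> norm (?c (exp (- t)) * ?G) + norm (?c (kernel1 t a) * ?F) + norm (?P * ?e)"
      unfolding err by (intro order_trans[OF norm_triangle_ineq4] add_right_mono norm_triangle_ineq)
    also have "\<dots> = exp (- t) * norm ?G + \<bar>kernel1 t a\<bar> * norm ?F + exp (- t * a) * norm (residual \<sigma> k v \<xi>)"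
      using False by (simp add: norm_mult residual_def a_def)
    also have "\<dots> \<le> 2 * exp (- t / 2) * norm ?G + 2 * exp (- t / 2) * norm ?F + exp (- t * a) * norm (residual \<sigma> k v \<xi>)"
      using et kernel1_half_bound[OF t, of a] False
      by (intro add_mono mult_right_mono) (auto intro: order_trans[of _ "2 * exp (- t)"])
    finally show ?thesis by (simp add: a_def algebra_simps)
  qed
qed

section \<open>Weighted heat integrals\<close>

text \<open>From s ln x \<le> s x \<le> s^2 + x^2/2. The growth costs only half of a factor
  exp(-x^2).\<close>

lemma powr_le_exp_square:
  fixes x s :: real
  assumes "x \<ge> 0" "s \<ge> 0"
  shows "x powr s \<le> exp (s\<^sup>2) * exp (x\<^sup>2 / 2)"
proof (cases "x = 0")
  case False
  then have x: "x > 0" using assms by simp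
  have "ln x \<le> x" using ln_le_minus_one[OF x] by simp
  then have "s * ln x \<le> s * x" using assms by (intro mult_left_mono) auto
  also have "s * x \<le> s\<^sup>2 + x\<^sup>2 / 2"
  proof -
    have "s\<^sup>2 + x\<^sup>2 / 2 - s * x = (s - x / 2)\<^sup>2 + (x / 2)\<^sup>2"
      by (simp add: power2_eq_square algebra_simps)
    also have "\<dots> \<ge> 0" by simp
    finally show ?thesis by simp
  qed
  finally show ?thesis using x by (simp add: powr_def mult.commute flip: exp_add)
qed simp

text \<open>The type argument carries the dimension, which the numerical arguments do not
  determine.\<close>

definition heat_moment :: "real \<Rightarrow> real \<Rightarrow> 'a::euclidean_space itself \<Rightarrow> real \<Rightarrow> ennreal" where
  "heat_moment \<sigma> s _ t = (\<integral>\<^sup>+\<xi>. ennreal (norm \<xi> powr s * exp (- t * norm \<xi> powr (2 * \<sigma>))) \<partial>(lebesgue :: 'a measure))"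

lemma heat_moment_scale:
  assumes "\<sigma> > 0" "t > 0"
  shows "heat_moment \<sigma> s TYPE('a::euclidean_space) t =
    ennreal (t powr (- (real DIM('a) + s) / (2 * \<sigma>))) * heat_moment \<sigma> s TYPE('a) 1"
proof -
  \<comment> \<open>The dilation that removes t: it satisfies t c^(2\<sigma>) = 1.\<close>
  define c where "c = t powr (- 1 / (2 * \<sigma>))"
  let ?h = "\<lambda>t \<xi>::'a. ennreal (norm \<xi> powr s * exp (- t * norm \<xi> powr (2 * \<sigma>)))"
  have c: "c > 0" using assms by (simp add: c_def)
  have tc: "t * c powr (2 * \<sigma>) = 1"
  proof -
    have "c powr (2 * \<sigma>) = t powr (- 1)" unfolding c_def powr_powr using assms by simp
    then show ?thesis using assms by (simp add: powr_minus)
  qed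
  have h: "?h t (c *\<^sub>R \<xi>) = ennreal (c powr s) * ?h 1 \<xi>" for \<xi> :: 'a
  proof -
    have "- t * norm (c *\<^sub>R \<xi>) powr (2 * \<sigma>) = - (t * c powr (2 * \<sigma>)) * norm \<xi> powr (2 * \<sigma>)"
      using c by (simp add: powr_mult)
    also have "\<dots> = - 1 * norm \<xi> powr (2 * \<sigma>)" unfolding tc ..
    finally have eq: "- t * norm (c *\<^sub>R \<xi>) powr (2 * \<sigma>) = - 1 * norm \<xi> powr (2 * \<sigma>)" .
    show ?thesis using c unfolding eq by (simp add: powr_mult ennreal_mult' mult.assoc)
  qed
  have "heat_moment \<sigma> s TYPE('a) t = (\<integral>\<^sup>+\<xi>. ?h t \<xi> \<partial>lborel)"
    by (simp add: heat_moment_def nn_integral_completion)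
  also have "\<dots> = ennreal (c ^ DIM('a)) * (\<integral>\<^sup>+\<xi>. ?h t (c *\<^sub>R \<xi>) \<partial>lborel)"
    using c by (subst lborel_affine[of c 0])
      (auto simp: nn_integral_density nn_integral_distr nn_integral_cmult)
  also have "\<dots> = ennreal (c ^ DIM('a)) * (ennreal (c powr s) * heat_moment \<sigma> s TYPE('a) 1)"
    unfolding h by (subst nn_integral_cmult) (auto simp: heat_moment_def nn_integral_completion)
  also have "\<dots> = ennreal (c ^ DIM('a) * c powr s) * heat_moment \<sigma> s TYPE('a) 1"
    using c by (simp add: ennreal_mult' mult.assoc)
  also have "c ^ DIM('a) * c powr s = t powr (- (real DIM('a) + s) / (2 * \<sigma>))"
  proof -
    have "c ^ DIM('a) * c powr s = c powr (real DIM('a) + s)"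
      using c by (simp add: powr_add powr_realpow)
    also have "\<dots> = t powr (- 1 / (2 * \<sigma>) * (real DIM('a) + s))" unfolding c_def powr_powr ..
    also have "- 1 / (2 * \<sigma>) * (real DIM('a) + s) = - (real DIM('a) + s) / (2 * \<sigma>)"
      unfolding minus_divide_left[symmetric] by simp
    finally show ?thesis .
  qed
  finally show ?thesis .
qed

text \<open>As \<sigma> \<ge> 1, |\<xi>|^(2\<sigma>) \<ge> |\<xi>|^2 - 1, which compares the heat
  factor with a Gaussian; half of its exponent absorbs the power of |\<xi>|.\<close>

lemma heat_moment_finite:
  assumes "\<sigma> \<ge> 1" "s \<ge> 0"
  shows "heat_moment \<sigma> s TYPE('a::euclidean_space) 1 < \<infinity>"
proof -
  have "norm \<xi> powr s * exp (- 1 * norm \<xi> powr (2 * \<sigma>)) \<le> exp (s\<^sup>2 + 1) * exp (- (1 * norm \<xi>)\<^sup>2 / 2)" for \<xi> :: 'a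
  proof -
    have "(norm \<xi>)\<^sup>2 - 1 \<le> norm \<xi> powr (2 * \<sigma>)"
    proof (cases "norm \<xi> \<ge> 1")
      case True
      then have "(norm \<xi>)\<^sup>2 = norm \<xi> powr 2" by (subst powr_numeral) auto
      also have "\<dots> \<le> norm \<xi> powr (2 * \<sigma>)" using True assms by (intro powr_mono) auto
      finally show ?thesis by simp
    next
      case False
      then have "(norm \<xi>)\<^sup>2 \<le> 1" by (simp add: power_le_one)
      then show ?thesis using powr_ge_zero[of "norm \<xi>" "2 * \<sigma>"] by linarith
    qed
    then have "norm \<xi> powr s * exp (- 1 * norm \<xi> powr (2 * \<sigma>)) \<le> 
        (exp (s\<^sup>2) * exp ((norm \<xi>)\<^sup>2 / 2)) * exp (1 - (norm \<xi>)\<^sup>2)"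
      using assms by (intro mult_mono powr_le_exp_square) auto
    also have "\<dots> = exp (s\<^sup>2 + 1) * exp (- (1 * norm \<xi>)\<^sup>2 / 2)"
      by (simp flip: exp_add)
    finally show ?thesis .
  qed
  then have "heat_moment \<sigma> s TYPE('a) 1 \<le> (\<integral>\<^sup>+\<xi>. ennreal (exp (s\<^sup>2 + 1) * exp (- (1 * norm \<xi>)\<^sup>2 / 2)) \<partial>(lebesgue :: 'a measure))"
    unfolding heat_moment_def by (intro nn_integral_mono ennreal_leI)
  also have "\<dots> < \<infinity>"
    using integrable_mult_right[OF integrable_lebesgue_gaussian[of 1, where 'a='a], of "exp (s\<^sup>2 + 1)"]
    by (simp add: nn_integral_eq_integral)
  finally show ?thesis .
qed

text \<open>Squaring produces two factors exp(-c): one goes into the heat moment, the other is set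
  aside to provide decay away from the origin.\<close>

lemma heat_weight_pointwise:
  fixes x y b c \<gamma> :: real
  assumes "0 \<le> y" "y \<le> b * x powr \<gamma>" "0 \<le> c"
  shows "(exp (- c) * y)\<^sup>2 \<le> b\<^sup>2 * exp (- c) * (x powr (2 * \<gamma>) * exp (- c))"
proof -
  have "(exp (- c) * y)\<^sup>2 \<le> (exp (- c) * (b * x powr \<gamma>))\<^sup>2"
    using assms by (intro power_mono mult_left_mono) auto
  also have "\<dots> = b\<^sup>2 * exp (- c) * ((x powr \<gamma> * x powr \<gamma>) * exp (- c))"
    by (simp add: power2_eq_square)
  finally show ?thesis by (simp flip: powr_add)
qed

text \<open>Frequencies near \<open>0\<close> carry the decay rate, the remaining ones decay exponentially in time.\<close>

lemma heat_weighted_split: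
  fixes R :: "'a::euclidean_space \<Rightarrow> complex"
  assumes R: "\<And>\<xi>. \<xi> \<noteq> 0 \<Longrightarrow> norm (R \<xi>) \<le> B * norm \<xi> powr \<gamma>" and t: "t \<ge> 0"
    and d: "d \<ge> 0" "\<And>\<xi>. \<xi> \<noteq> 0 \<Longrightarrow> norm \<xi> < d \<Longrightarrow> norm (R \<xi>) \<le> e * norm \<xi> powr \<gamma>" and "\<sigma> \<ge> 0"
  shows "(\<integral>\<^sup>+\<xi>. ennreal ((exp (- t * norm \<xi> powr (2 * \<sigma>)) * norm (R \<xi>))\<^sup>2) \<partial>lebesgue) \<le>
    ennreal (e\<^sup>2 + B\<^sup>2 * exp (- t * d powr (2 * \<sigma>))) * heat_moment \<sigma> (2 * \<gamma>) TYPE('a) t"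
    (is "_ \<le> ennreal ?K * _")
proof -
  have "(\<integral>\<^sup>+\<xi>. ennreal ((exp (- t * norm \<xi> powr (2 * \<sigma>)) * norm (R \<xi>))\<^sup>2) \<partial>lebesgue) \<le>
    (\<integral>\<^sup>+\<xi>. ennreal ?K * ennreal (norm \<xi> powr (2 * \<gamma>) * exp (- t * norm \<xi> powr (2 * \<sigma>))) \<partial>(lebesgue :: 'a measure))"
  proof (rule nn_integral_mono_AE)
    \<comment> \<open>The bounds on R say nothing at the origin, which is a null set.\<close>
    have "AE \<xi> in (lebesgue :: 'a measure). \<xi> \<noteq> 0" by (intro AE_completion AE_lborel_singleton)
    then show "AE \<xi> in lebesgue. ennreal ((exp (- t * norm \<xi> powr (2 * \<sigma>)) * norm (R \<xi>))\<^sup>2) \<le>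
        ennreal ?K * ennreal (norm \<xi> powr (2 * \<gamma>) * exp (- t * norm \<xi> powr (2 * \<sigma>)))"
    proof eventually_elim
      case (elim \<xi>)
      let ?c = "t * norm \<xi> powr (2 * \<sigma>)"
      define b where "b = (if norm \<xi> < d then e else B)"
      have le: "(exp (- ?c) * norm (R \<xi>))\<^sup>2 \<le> b\<^sup>2 * exp (- ?c) * (norm \<xi> powr (2 * \<gamma>) * exp (- ?c))"
        using R[OF elim] d(2)[OF elim] t by (intro heat_weight_pointwise) (auto simp: b_def)
      have "b\<^sup>2 * exp (- ?c) \<le> ?K"
      proof (cases "norm \<xi> < d")
        case True
        have "e\<^sup>2 * exp (- ?c) \<le> e\<^sup>2" using t by (intro mult_left_le) auto
        moreover have "0 \<le> B\<^sup>2 * exp (- t * d powr (2 * \<sigma>))" by simp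
        ultimately show ?thesis using True by (simp only: b_def if_True)
      next
        case False
        then have "t * d powr (2 * \<sigma>) \<le> ?c" using d(1) assms(5) t by (intro mult_left_mono powr_mono2) auto
        then have "B\<^sup>2 * exp (- ?c) \<le> B\<^sup>2 * exp (- t * d powr (2 * \<sigma>))" by (intro mult_left_mono) auto
        moreover have "0 \<le> e\<^sup>2" by simp
        ultimately show ?thesis using False by (simp only: b_def if_False)
      qed
      then have "b\<^sup>2 * exp (- ?c) * (norm \<xi> powr (2 * \<gamma>) * exp (- ?c)) \<le>
          ?K * (norm \<xi> powr (2 * \<gamma>) * exp (- ?c))"
        by (rule mult_right_mono) simp
      with le have "ennreal ((exp (- ?c) * norm (R \<xi>))\<^sup>2) \<le> ennreal (?K * (norm \<xi> powr (2 * \<gamma>) * exp (- ?c)))"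
        by (intro ennreal_leI) (rule order_trans)
      moreover have "?K \<ge> 0" by simp
      ultimately show ?case by (simp only: ennreal_mult' mult_minus_left)
    qed
  qed
  also have "\<dots> = ennreal ?K * heat_moment \<sigma> (2 * \<gamma>) TYPE('a) t"
    unfolding heat_moment_def by (rule nn_integral_cmult) (rule borel_measurable_lebesgue_comp, measurable)
  finally show ?thesis .
qed

text \<open>The split at radius 0: no frequency is near, and
  \<open>0 powr (2 * \<sigma>) = 0\<close> makes the exponential factor 1.\<close>

lemma heat_weighted_le:
  fixes R :: "'a::euclidean_space \<Rightarrow> complex"
  assumes "\<And>\<xi>. \<xi> \<noteq> 0 \<Longrightarrow> norm (R \<xi>) \<le> B * norm \<xi> powr \<gamma>" and "t \<ge> 0" and "\<sigma> \<ge> 0"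
  shows "(\<integral>\<^sup>+\<xi>. ennreal ((exp (- t * norm \<xi> powr (2 * \<sigma>)) * norm (R \<xi>))\<^sup>2) \<partial>lebesgue) \<le>
    ennreal (B\<^sup>2) * heat_moment \<sigma> (2 * \<gamma>) TYPE('a) t"
  using heat_weighted_split[where d = 0 and e = 0 and \<sigma> = \<sigma>, OF assms(1,2)] assms(3) by simp

section \<open>The rescaled limit of the weighted heat integral\<close>

lemma tendsto_0_ennrealI:
  fixes f :: "'b \<Rightarrow> ennreal"
  assumes "\<And>e::real. e > 0 \<Longrightarrow> \<forall>\<^sub>F x in F. f x \<le> ennreal e"
  shows "(f \<longlongrightarrow> 0) F"
proof (rule order_tendstoI)
  fix a :: ennreal assume "0 < a"
  then obtain e where e: "e > 0" "ennreal e < a"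
  proof (cases a)
    case (real r)
    with \<open>0 < a\<close> that[of "r / 2"] show ?thesis by (auto simp: ennreal_less_iff)
  next
    case top
    with that[of 1] show ?thesis by auto
  qed
  show "\<forall>\<^sub>F x in F. f x < a"
    using assms[OF e(1)] by eventually_elim (use e(2) in auto)
qed auto

lemma exp_minus_mult_at_top:
  fixes c :: real
  assumes "c > 0"
  shows "((\<lambda>t. exp (- t * c)) \<longlongrightarrow> 0) at_top"
proof (rule filterlim_compose[OF exp_at_bot])
  have "filterlim (\<lambda>t. t * c) at_top at_top"
    by (rule filterlim_at_top_mult_tendsto_pos[OF tendsto_const assms filterlim_ident])
  then show "filterlim (\<lambda>t. - t * c) at_bot at_top"
    by (simp add: filterlim_uminus_at_bot)
qed

lemma heat_weighted_tendsto:
  fixes R :: "'a::euclidean_space \<Rightarrow> complex"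
  assumes R: "\<And>\<xi>. \<xi> \<noteq> 0 \<Longrightarrow> norm (R \<xi>) \<le> B * norm \<xi> powr \<gamma>"
    and lim: "((\<lambda>\<xi>. norm (R \<xi>) / norm \<xi> powr \<gamma>) \<longlongrightarrow> 0) (at 0)"
    and "\<sigma> \<ge> 1" "\<gamma> \<ge> 0"
  shows "((\<lambda>t. ennreal (t powr ((real DIM('a) + 2 * \<gamma>) / (2 * \<sigma>))) *
     (\<integral>\<^sup>+\<xi>. ennreal ((exp (- t * norm \<xi> powr (2 * \<sigma>)) * norm (R \<xi>))\<^sup>2) \<partial>lebesgue)) \<longlongrightarrow> 0) at_top"
proof (rule tendsto_0_ennrealI)
  fix \<epsilon> :: real assume "\<epsilon> > 0"
  let ?q = "(real DIM('a) + 2 * \<gamma>) / (2 * \<sigma>)"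
  obtain j where j: "j \<ge> 0" "heat_moment \<sigma> (2 * \<gamma>) TYPE('a) 1 = ennreal j"
    using heat_moment_finite[of \<sigma> "2 * \<gamma>", where 'a='a] assms(3,4)
    by (cases "heat_moment \<sigma> (2 * \<gamma>) TYPE('a) 1") auto
  \<comment> \<open>Makes the near part e^2 j at most \<epsilon>/2; adding 1 to j avoids a division
    by zero.\<close>
  define e where "e = sqrt (\<epsilon> / 2 / (j + 1))"
  have e: "e > 0" "e\<^sup>2 = \<epsilon> / 2 / (j + 1)" using \<open>\<epsilon> > 0\<close> j(1) by (auto simp: e_def)
  obtain d where d: "d > 0" and "\<And>\<xi>. \<xi> \<noteq> 0 \<Longrightarrow> dist \<xi> 0 < d \<Longrightarrow> norm (R \<xi>) / norm \<xi> powr \<gamma> < e"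
    using order_tendstoD(2)[OF lim e(1)] unfolding eventually_at by blast
  then have Rd: "norm (R \<xi>) \<le> e * norm \<xi> powr \<gamma>" if "\<xi> \<noteq> 0" "norm \<xi> < d" for \<xi>
    using that by (fastforce simp: divide_less_eq)
  have dp: "d powr (2 * \<sigma>) > 0" using d by simp
  have "((\<lambda>t. (B\<^sup>2 * exp (- t * d powr (2 * \<sigma>))) * j) \<longlongrightarrow> (B\<^sup>2 * 0) * j) at_top"
    by (intro tendsto_intros exp_minus_mult_at_top dp)
  then have "\<forall>\<^sub>F t in at_top. (B\<^sup>2 * exp (- t * d powr (2 * \<sigma>))) * j < \<epsilon> / 2"
    using \<open>\<epsilon> > 0\<close> by (intro order_tendstoD(2)) auto
  then show "\<forall>\<^sub>F t in at_top. ennreal (t powr ?q) *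
     (\<integral>\<^sup>+\<xi>. ennreal ((exp (- t * norm \<xi> powr (2 * \<sigma>)) * norm (R \<xi>))\<^sup>2) \<partial>lebesgue) \<le> ennreal \<epsilon>"
    using eventually_gt_at_top[of 0]
  proof eventually_elim
    case (elim t)
    let ?K = "e\<^sup>2 + B\<^sup>2 * exp (- t * d powr (2 * \<sigma>))"
    have "ennreal (t powr ?q) *
       (\<integral>\<^sup>+\<xi>. ennreal ((exp (- t * norm \<xi> powr (2 * \<sigma>)) * norm (R \<xi>))\<^sup>2) \<partial>lebesgue) \<le>
       ennreal (t powr ?q) * (ennreal ?K * (ennreal (t powr (- (real DIM('a) + 2 * \<gamma>) / (2 * \<sigma>))) * ennreal j))"
      using heat_weighted_split[of R B \<gamma> t d e \<sigma>] R elim d Rd assms(3)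
      unfolding heat_moment_scale[OF order_less_le_trans[OF zero_less_one assms(3)] elim(2)] j(2)
      by (intro mult_left_mono) auto
    also have "\<dots> = ennreal (t powr ?q * (?K * (t powr (- (real DIM('a) + 2 * \<gamma>) / (2 * \<sigma>)) * j)))"
      using j(1) by (simp add: ennreal_mult)
    also have "t powr ?q * (?K * (t powr (- (real DIM('a) + 2 * \<gamma>) / (2 * \<sigma>)) * j)) = ?K * j"
    proof -
      have "- (real DIM('a) + 2 * \<gamma>) / (2 * \<sigma>) = - ?q"
        unfolding minus_divide_left[symmetric] ..
      then show ?thesis using elim(2) by (simp only: powr_minus) simp
    qed
    also have "?K * j \<le> \<epsilon>"
    proof -
      have "e\<^sup>2 * j \<le> \<epsilon> / 2" using j(1) \<open>\<epsilon> > 0\<close> by (simp add: e(2) field_simps)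
      with elim(1) show ?thesis by (simp add: distrib_right)
    qed
    finally show ?case by (simp add: ennreal_leI)
  qed
qed

section \<open>The asymptotic expansion\<close>

text \<open>The inequality ln y \<le> y - 1 at y = t/q, multiplied by q and exponentiated.\<close>

lemma powr_le_powr_self_exp:
  fixes t q :: real
  assumes "t > 0" "q > 0"
  shows "t powr q \<le> q powr q * exp t"
proof -
  have "q * ln (t / q) \<le> q * (t / q - 1)"
    using assms by (intro mult_left_mono ln_le_minus_one) auto
  also have "\<dots> \<le> t" using assms by (simp add: field_simps)
  finally have "(t / q) powr q \<le> exp t" using assms by (simp add: powr_def)
  then have "q powr q * (t / q) powr q \<le> q powr q * exp t" by (intro mult_left_mono) auto
  then show ?thesis using assms by (simp add: powr_divide)
qed

lemma powr_exp_tendsto_0: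
  fixes q :: real
  assumes "q > 0"
  shows "((\<lambda>t. t powr q * exp (- t)) \<longlongrightarrow> 0) at_top"
proof (rule Lim_null_comparison)
  \<comment> \<open>The exponential bound at exponent q + 1 leaves a spare factor 1/t.\<close>
  let ?c = "(q + 1) powr (q + 1)"
  show "\<forall>\<^sub>F t in at_top. norm (t powr q * exp (- t)) \<le> ?c * inverse t"
    using eventually_gt_at_top[of 0]
  proof eventually_elim
    case (elim t)
    have "t powr (q + 1) * exp (- t) \<le> ?c * exp t * exp (- t)"
      using elim assms by (intro mult_right_mono powr_le_powr_self_exp) auto
    also have "\<dots> = ?c" by (simp flip: exp_add add: mult.assoc)
    finally have "(t powr q * exp (- t)) * t \<le> ?c" using elim by (simp add: powr_add mult_ac)
    then show ?case using elim by (simp add: field_simps)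
  qed
  have "((\<lambda>t::real. ?c * inverse t) \<longlongrightarrow> ?c * 0) at_top"
    by (intro tendsto_intros tendsto_inverse_0_at_top filterlim_ident)
  then show "((\<lambda>t::real. ?c * inverse t) \<longlongrightarrow> 0) at_top" by simp
qed

section \<open>Passage from the pointwise error to squared L^2 norms\<close>

lemma ennreal_L2_norm_power2:
  fixes f :: "real ^ 'n \<Rightarrow> complex"
  assumes "f \<in> L2"
  shows "ennreal ((L2_norm f)\<^sup>2) = (\<integral>\<^sup>+x. ennreal ((norm (f x))\<^sup>2) \<partial>lebesgue)"
proof -
  have "(LINT x|lebesgue. (norm (f x))\<^sup>2) \<ge> 0" by (rule integral_nonneg_AE) auto
  then show ?thesis
    using assms by (simp add: L2_norm_def L2_def nn_integral_eq_integral)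
qed

lemma L2_I:
  fixes f :: "real ^ 'n \<Rightarrow> complex"
  assumes "f \<in> borel_measurable lebesgue" "(\<integral>\<^sup>+x. ennreal ((norm (f x))\<^sup>2) \<partial>lebesgue) < \<infinity>"
  shows "f \<in> L2"
  using assms by (auto simp: L2_def integrable_iff_bounded)

lemma borel_measurable_asymp_error:
  fixes u0 u1 :: "real ^ 'n \<Rightarrow> complex"
  assumes "integrable lebesgue u0" "integrable lebesgue u1"
  shows "asymp_error \<sigma> k u0 u1 t \<in> borel_measurable lebesgue"
proof -
  have [measurable]: "kernel0 t \<in> borel_measurable borel" "kernel1 t \<in> borel_measurable borel"
    unfolding kernel0_def[abs_def] kernel1_def[abs_def] by measurable
  have 1: "(\<lambda>\<xi>::real^'n. complex_of_real (kernel0 t (norm \<xi> powr (2 * \<sigma>)))) \<in> borel_measurable borel"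
    "(\<lambda>\<xi>::real^'n. complex_of_real (kernel1 t (norm \<xi> powr (2 * \<sigma>)))) \<in> borel_measurable borel"
    "(\<lambda>\<xi>::real^'n. complex_of_real (exp (- t * norm \<xi> powr (2 * \<sigma>)))) \<in> borel_measurable borel"
    by measurable
  note [measurable] = borel_measurable_fourier[OF assms(1)] borel_measurable_fourier[OF assms(2)]
    1[THEN borel_measurable_lebesgue_comp] borel_measurable_lebesgue_comp[OF borel_measurable_profile]
  show ?thesis unfolding asymp_error_def[abs_def] solution_hat_def[abs_def] by measurable
qed

lemma nn_integral_asymp_error_le:
  fixes u0 u1 :: "real ^ 'n \<Rightarrow> complex" and \<sigma> :: real and k :: nat
  assumes u: "integrable lebesgue u0" "integrable lebesgue u1" "u0 \<in> L2" "u1 \<in> L2" and t: "t \<ge> 0"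
  defines "R \<equiv> residual \<sigma> k (\<lambda>x. u0 x + u1 x)"
  shows "(\<integral>\<^sup>+\<xi>. ennreal ((norm (asymp_error \<sigma> k u0 u1 t \<xi>))\<^sup>2) \<partial>lebesgue) \<le>
    2 * (\<integral>\<^sup>+\<xi>. ennreal ((exp (- t * norm \<xi> powr (2 * \<sigma>)) * norm (R \<xi>))\<^sup>2) \<partial>lebesgue) +
    ennreal (64 * (2 * pi) ^ CARD('n) * exp (- t) * ((L2_norm u0)\<^sup>2 + (L2_norm u1)\<^sup>2))"
proof -
  let ?F0 = "\<lambda>\<xi>. ennreal ((norm (fourier u0 \<xi>))\<^sup>2)" and ?F1 = "\<lambda>\<xi>. ennreal ((norm (fourier u1 \<xi>))\<^sup>2)"
  \<comment> \<open>64 = 2 * 4 * 8: a factor 2 from squaring a sum, 4 exp(-t) from squaring 2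
    exp(-t/2), and 8 from (2f + g)^2 \<le> 8f^2 + 8g^2. Here 2f + g bounds |u0^| + |v^|, the
    transform of u0 occurring also in that of v.\<close>
  let ?c = "64 * exp (- t)"
  let ?A = "\<lambda>\<xi>. ennreal ((exp (- t * norm \<xi> powr (2 * \<sigma>)) * norm (R \<xi>))\<^sup>2)"
  note [measurable] = borel_measurable_fourier[OF u(1)] borel_measurable_fourier[OF u(2)]
  have Rm [measurable]: "R \<in> borel_measurable lebesgue"
    unfolding R_def using u by (intro borel_measurable_residual) auto
  have "(\<lambda>\<xi>::real^'n. exp (- t * norm \<xi> powr (2 * \<sigma>))) \<in> borel_measurable borel" by measurable
  note [measurable] = borel_measurable_lebesgue_comp[OF this]
  have Am: "?A \<in> borel_measurable lebesgue" by measurable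
  have pw: "ennreal ((norm (asymp_error \<sigma> k u0 u1 t \<xi>))\<^sup>2) \<le> 2 * ?A \<xi> + (ennreal ?c * ?F0 \<xi> + ennreal ?c * ?F1 \<xi>)" for \<xi>
  proof -
    define r f g where "r = exp (- t * norm \<xi> powr (2 * \<sigma>)) * norm (R \<xi>)"
      and "f = norm (fourier u0 \<xi>)" and "g = norm (fourier u1 \<xi>)"
    have "norm (fourier (\<lambda>x. u0 x + u1 x) \<xi>) \<le> f + g"
      unfolding fourier_add[OF u(1,2)] f_def g_def by (rule norm_triangle_ineq)
    then have "2 * exp (- t / 2) * (f + norm (fourier (\<lambda>x. u0 x + u1 x) \<xi>)) \<le> 2 * exp (- t / 2) * (2 * f + g)"
      by (intro mult_left_mono) auto
    then have "norm (asymp_error \<sigma> k u0 u1 t \<xi>) \<le> r + 2 * exp (- t / 2) * (2 * f + g)"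
      using norm_asymp_error_le[OF u(1,2) t, of \<sigma> k \<xi>, folded R_def, folded r_def f_def]
      by linarith
    then have "(norm (asymp_error \<sigma> k u0 u1 t \<xi>))\<^sup>2 \<le> (r + 2 * exp (- t / 2) * (2 * f + g))\<^sup>2"
      by (intro power_mono) auto
    also have "\<dots> \<le> 2 * r\<^sup>2 + 2 * (2 * exp (- t / 2) * (2 * f + g))\<^sup>2"
      using sum_squares_bound[of r "2 * exp (- t / 2) * (2 * f + g)"] by (simp add: power2_sum)
    also have "(2 * exp (- t / 2) * (2 * f + g))\<^sup>2 = 4 * exp (- t) * (2 * f + g)\<^sup>2"
      by (simp add: power_mult_distrib flip: exp_double)
    also have "(2 * f + g)\<^sup>2 \<le> 8 * f\<^sup>2 + 8 * g\<^sup>2"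
    proof -
      have "(2 * f)\<^sup>2 = 4 * f\<^sup>2" by (simp add: power_mult_distrib)
      then show ?thesis
        using sum_squares_bound[of "2 * f" g] zero_le_power2[of f] zero_le_power2[of g]
        unfolding power2_sum by linarith
    qed
    finally have "(norm (asymp_error \<sigma> k u0 u1 t \<xi>))\<^sup>2 \<le> 2 * r\<^sup>2 + (?c * f\<^sup>2 + ?c * g\<^sup>2)"
      by (simp add: algebra_simps)
    then have "ennreal ((norm (asymp_error \<sigma> k u0 u1 t \<xi>))\<^sup>2) \<le> ennreal (2 * r\<^sup>2 + (?c * f\<^sup>2 + ?c * g\<^sup>2))"
      by (rule ennreal_leI)
    also have "\<dots> = 2 * ennreal (r\<^sup>2) + (ennreal ?c * ennreal (f\<^sup>2) + ennreal ?c * ennreal (g\<^sup>2))"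
      by (simp add: ennreal_mult')
    finally show ?thesis by (simp only: r_def f_def g_def)
  qed
  have "(\<integral>\<^sup>+\<xi>. ennreal ((norm (asymp_error \<sigma> k u0 u1 t \<xi>))\<^sup>2) \<partial>lebesgue) \<le>
      (\<integral>\<^sup>+\<xi>. 2 * ?A \<xi> + (ennreal ?c * ?F0 \<xi> + ennreal ?c * ?F1 \<xi>) \<partial>lebesgue)"
    by (intro nn_integral_mono pw)
  also have "\<dots> = 2 * (\<integral>\<^sup>+\<xi>. ?A \<xi> \<partial>lebesgue) +
      (ennreal ?c * (\<integral>\<^sup>+\<xi>. ?F0 \<xi> \<partial>lebesgue) + ennreal ?c * (\<integral>\<^sup>+\<xi>. ?F1 \<xi> \<partial>lebesgue))"
    using Am by (simp add: nn_integral_add nn_integral_cmult)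
  also have "\<dots> \<le> 2 * (\<integral>\<^sup>+\<xi>. ?A \<xi> \<partial>lebesgue) +
      (ennreal ?c * (ennreal ((2 * pi) ^ CARD('n)) * ennreal ((L2_norm u0)\<^sup>2)) +
       ennreal ?c * (ennreal ((2 * pi) ^ CARD('n)) * ennreal ((L2_norm u1)\<^sup>2)))"
    unfolding ennreal_L2_norm_power2[OF u(3)] ennreal_L2_norm_power2[OF u(4)]
    by (intro add_mono order_refl mult_left_mono nn_integral_fourier_le u) auto
  also have "(ennreal ?c * (ennreal ((2 * pi) ^ CARD('n)) * ennreal ((L2_norm u0)\<^sup>2)) +
       ennreal ?c * (ennreal ((2 * pi) ^ CARD('n)) * ennreal ((L2_norm u1)\<^sup>2))) =
       ennreal (?c * ((2 * pi) ^ CARD('n) * (L2_norm u0)\<^sup>2) + ?c * ((2 * pi) ^ CARD('n) * (L2_norm u1)\<^sup>2))"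
    by (simp add: ennreal_mult' ennreal_plus)
  also have "?c * ((2 * pi) ^ CARD('n) * (L2_norm u0)\<^sup>2) + ?c * ((2 * pi) ^ CARD('n) * (L2_norm u1)\<^sup>2) =
      64 * (2 * pi) ^ CARD('n) * exp (- t) * ((L2_norm u0)\<^sup>2 + (L2_norm u1)\<^sup>2)"
    by (simp add: algebra_simps)
  finally show ?thesis .
qed

theorem theorem1p1:
  fixes \<sigma> \<gamma> :: real and k :: nat
  assumes "\<sigma> \<ge> 1" and "\<gamma> \<ge> 0"
    and "lambda_seq \<sigma> k \<le> \<gamma>" and "\<gamma> < lambda_seq \<sigma> (Suc k)"
  shows "(\<exists>C>0. \<forall>u0 \<in> wL1 \<gamma> \<inter> L2. \<forall>u1 \<in> wL1 \<gamma> \<inter> L2. \<forall>t\<ge>1.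
            asymp_error \<sigma> k u0 u1 t \<in> (L2 :: (real ^ 'n \<Rightarrow> complex) set) \<and>
            L2_norm (asymp_error \<sigma> k u0 u1 t)
              \<le> C * t powr (- (real CARD('n) / (4 * \<sigma>)) - \<gamma> / (2 * \<sigma>)) *
                (wL1_norm \<gamma> (\<lambda>x. u0 x + u1 x) + L1L2_norm u0 + L1L2_norm u1))
       \<and> (\<forall>u0 \<in> wL1 \<gamma> \<inter> L2. \<forall>u1 \<in> (wL1 \<gamma> \<inter> L2 :: (real ^ 'n \<Rightarrow> complex) set).
            ((\<lambda>t. t powr (real CARD('n) / (4 * \<sigma>) + \<gamma> / (2 * \<sigma>)) *
                  L2_norm (asymp_error \<sigma> k u0 u1 t)) \<longlongrightarrow> 0) at_top)"
proof -
  \<comment> \<open>Twice the decay exponent of the theorem, because the estimates are for squared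
    norms.\<close>
  define q where "q = (real CARD('n) + 2 * \<gamma>) / (2 * \<sigma>)"
  define K where "K = 2 * real (Suc (nat \<lfloor>\<gamma> / (2 * \<sigma>)\<rfloor>)) + 2 + real (Suc (nat \<lfloor>\<gamma> / (2 * \<sigma>)\<rfloor>)) * 2 powr \<gamma>"
  define P where "P = 64 * (2 * pi) ^ CARD('n)"
  let ?v = "\<lambda>u0 u1 (x :: real ^ 'n). u0 x + u1 x :: complex"
  let ?A = "\<lambda>u0 u1 t. \<integral>\<^sup>+\<xi>. ennreal ((exp (- t * norm \<xi> powr (2 * \<sigma>)) *
    norm (residual \<sigma> k (?v u0 u1) \<xi>))\<^sup>2) \<partial>lebesgue"
  have q: "q > 0" using assms by (simp add: q_def add_pos_nonneg)
  have q2: "- (real CARD('n) / (4 * \<sigma>)) - \<gamma> / (2 * \<sigma>) = - (q / 2)"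
    "real CARD('n) / (4 * \<sigma>) + \<gamma> / (2 * \<sigma>) = q / 2"
    using assms(1) by (auto simp: q_def field_simps)
  have P: "P > 0" by (simp add: P_def)
  obtain j where j: "j \<ge> 0" "heat_moment \<sigma> (2 * \<gamma>) TYPE(real ^ 'n) 1 = ennreal j"
    using heat_moment_finite[of \<sigma> "2 * \<gamma>", where 'a="real ^ 'n"] assms(1,2)
    by (cases "heat_moment \<sigma> (2 * \<gamma>) TYPE(real ^ 'n) 1") auto
  have hm: "heat_moment \<sigma> (2 * \<gamma>) TYPE(real ^ 'n) t = ennreal (t powr (- q) * j)" if "t > 0" for t
  proof -
    have "- (real DIM(real ^ 'n) + 2 * \<gamma>) / (2 * \<sigma>) = - q" unfolding minus_divide_left[symmetric] by (simp add: q_def)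
    then show ?thesis
      using heat_moment_scale[of \<sigma> t "2 * \<gamma>", where 'a="real ^ 'n"] that assms(1) j
      by (simp only:) (simp add: ennreal_mult')
  qed
  have res: "norm (residual \<sigma> k (?v u0 u1) \<xi>) \<le> K * wL1_norm \<gamma> (?v u0 u1) * norm \<xi> powr \<gamma>"
    if "u0 \<in> wL1 \<gamma>" "u1 \<in> wL1 \<gamma>" "\<xi> \<noteq> 0" for u0 u1 \<xi>
    unfolding K_def by (rule norm_residual_le[OF assms wL1_add[OF that(1,2)] that(3)])
  have E: "(\<integral>\<^sup>+\<xi>. ennreal ((norm (asymp_error \<sigma> k u0 u1 t \<xi>))\<^sup>2) \<partial>lebesgue) \<le>
      2 * ?A u0 u1 t + ennreal (P * exp (- t) * ((L2_norm u0)\<^sup>2 + (L2_norm u1)\<^sup>2))"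
    if "u0 \<in> wL1 \<gamma> \<inter> L2" "u1 \<in> wL1 \<gamma> \<inter> L2" "t \<ge> 0" for u0 u1 :: "real ^ 'n \<Rightarrow> complex" and t
    unfolding P_def using that by (intro nn_integral_asymp_error_le) (auto simp: wL1_def)
  \<comment> \<open>The first term comes from the residual, the second from exp(-t) \<le> q^q
    t^(-q), which converts the exponentially small part to the same rate.\<close>
  define M where "M = 2 * K\<^sup>2 * j + P * q powr q"
  have M: "M > 0" using P q j(1) by (simp add: M_def add_nonneg_pos)
  have bound: "(\<integral>\<^sup>+\<xi>. ennreal ((norm (asymp_error \<sigma> k u0 u1 t \<xi>))\<^sup>2) \<partial>lebesgue) \<le>
      ennreal (M * t powr (- q) * (wL1_norm \<gamma> (?v u0 u1) + L1L2_norm u0 + L1L2_norm u1)\<^sup>2)"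
    if u: "u0 \<in> wL1 \<gamma> \<inter> L2" "u1 \<in> wL1 \<gamma> \<inter> L2" and t: "t \<ge> 1" for u0 u1 :: "real ^ 'n \<Rightarrow> complex" and t
  proof -
    let ?w = "wL1_norm \<gamma> (?v u0 u1)" and ?l0 = "L2_norm u0" and ?l1 = "L2_norm u1"
    have nn: "?w \<ge> 0" "?l0 \<ge> 0" "?l1 \<ge> 0" "L1_norm u0 \<ge> 0" "L1_norm u1 \<ge> 0"
      by (auto simp: wL1_norm_nonneg L2_norm_def L1_norm_def intro!: integral_nonneg_AE)
    have "?A u0 u1 t \<le> ennreal ((K * ?w)\<^sup>2) * ennreal (t powr (- q) * j)"
      using t u assms(1) heat_weighted_le[of "residual \<sigma> k (?v u0 u1)" "K * ?w" \<gamma> t \<sigma>, OF res]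
      by (simp add: hm)
    then have "2 * ?A u0 u1 t + ennreal (P * exp (- t) * (?l0\<^sup>2 + ?l1\<^sup>2)) \<le>
        2 * (ennreal ((K * ?w)\<^sup>2) * ennreal (t powr (- q) * j)) + ennreal (P * exp (- t) * (?l0\<^sup>2 + ?l1\<^sup>2))"
      by (intro add_right_mono mult_left_mono) auto
    also have "\<dots> = ennreal (2 * ((K * ?w)\<^sup>2 * (t powr (- q) * j)) + P * exp (- t) * (?l0\<^sup>2 + ?l1\<^sup>2))"
      using P j(1) by (simp add: ennreal_mult')
    also have "\<dots> \<le> ennreal (M * t powr (- q) * (?w + L1L2_norm u0 + L1L2_norm u1)\<^sup>2)"
    proof (rule ennreal_leI)
      let ?S = "?w\<^sup>2 + ?l0\<^sup>2 + ?l1\<^sup>2"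
      have "exp (- t) \<le> q powr q * t powr (- q)"
        using powr_le_powr_self_exp[of t q] t q by (simp add: powr_minus exp_minus field_simps)
      then have "P * exp (- t) * (?l0\<^sup>2 + ?l1\<^sup>2) \<le> P * (q powr q * t powr (- q)) * ?S"
        using P by (intro mult_mono mult_left_mono) auto
      moreover have "2 * ((K * ?w)\<^sup>2 * (t powr (- q) * j)) \<le> 2 * K\<^sup>2 * j * t powr (- q) * ?S"
      proof -
        have "2 * ((K * ?w)\<^sup>2 * (t powr (- q) * j)) = 2 * K\<^sup>2 * j * t powr (- q) * ?w\<^sup>2"
          by (simp add: power_mult_distrib mult_ac)
        also have "\<dots> \<le> 2 * K\<^sup>2 * j * t powr (- q) * ?S" using j(1) by (intro mult_left_mono) auto
        finally show ?thesis .
      qed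
      ultimately have "2 * ((K * ?w)\<^sup>2 * (t powr (- q) * j)) + P * exp (- t) * (?l0\<^sup>2 + ?l1\<^sup>2) \<le>
          M * t powr (- q) * ?S"
        by (simp add: M_def algebra_simps)
      \<comment> \<open>A sum of squares of nonnegative numbers is at most the square of their
        sum.\<close>
      also have "?S \<le> (?w + ?l0 + ?l1)\<^sup>2"
        using nn by (simp add: power2_sum)
      also have "\<dots> \<le> (?w + L1L2_norm u0 + L1L2_norm u1)\<^sup>2"
        using nn by (intro power_mono) (auto simp: L1L2_norm_def)
      finally show "2 * ((K * ?w)\<^sup>2 * (t powr (- q) * j)) + P * exp (- t) * (?l0\<^sup>2 + ?l1\<^sup>2) \<le>
          M * t powr (- q) * (?w + L1L2_norm u0 + L1L2_norm u1)\<^sup>2"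
        using M by (simp add: mult_left_mono)
    qed
    finally show ?thesis using t by (intro order_trans[OF E[OF u, of t]]) simp_all
  qed
  \<comment> \<open>Only from here on does \<open>L2_norm\<close> of the error stand for the
    extended integral that has been estimated; a divergent integral would have given norm 0.\<close>
  have L2: "asymp_error \<sigma> k u0 u1 t \<in> L2"
    if u: "u0 \<in> wL1 \<gamma> \<inter> L2" "u1 \<in> wL1 \<gamma> \<inter> L2" and t: "t \<ge> 1" for u0 u1 :: "real ^ 'n \<Rightarrow> complex" and t
    using u by (intro L2_I le_less_trans[OF bound[OF that]] borel_measurable_asymp_error) (auto simp: wL1_def)
  show ?thesis
  proof (intro conjI exI[of _ "sqrt M"] ballI allI impI)
    show "sqrt M > 0" using M by simp
  next
    fix u0 u1 :: "real ^ 'n \<Rightarrow> complex" and t :: real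
    assume u: "u0 \<in> wL1 \<gamma> \<inter> L2" "u1 \<in> wL1 \<gamma> \<inter> L2" and t: "t \<ge> 1"
    show "asymp_error \<sigma> k u0 u1 t \<in> L2" by (rule L2[OF u t])
    let ?S = "wL1_norm \<gamma> (?v u0 u1) + L1L2_norm u0 + L1L2_norm u1"
    have S: "?S \<ge> 0"
      by (auto simp: wL1_norm_nonneg L1L2_norm_def L2_norm_def L1_norm_def intro!: add_nonneg_nonneg integral_nonneg_AE)
    have "(L2_norm (asymp_error \<sigma> k u0 u1 t))\<^sup>2 \<le> M * t powr (- q) * ?S\<^sup>2"
      using bound[OF u t] M unfolding ennreal_L2_norm_power2[OF L2[OF u t], symmetric]
      by (simp add: ennreal_le_iff)
    also have "\<dots> = (sqrt M * t powr (- (q / 2)) * ?S)\<^sup>2"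
      using M by (simp add: power_mult_distrib power2_eq_square[of "t powr _"] flip: powr_add)
    finally have "L2_norm (asymp_error \<sigma> k u0 u1 t) \<le> sqrt M * t powr (- (q / 2)) * ?S"
      by (rule power2_le_imp_le) (use M S in auto)
    then show "L2_norm (asymp_error \<sigma> k u0 u1 t)
              \<le> sqrt M * t powr (- (real CARD('n) / (4 * \<sigma>)) - \<gamma> / (2 * \<sigma>)) * ?S"
      unfolding q2 .
  next
    fix u0 u1 :: "real ^ 'n \<Rightarrow> complex"
    assume u: "u0 \<in> wL1 \<gamma> \<inter> L2" "u1 \<in> wL1 \<gamma> \<inter> L2"
    let ?l = "(L2_norm u0)\<^sup>2 + (L2_norm u1)\<^sup>2" and ?e = "\<lambda>t. L2_norm (asymp_error \<sigma> k u0 u1 t)"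
    have wv: "?v u0 u1 \<in> wL1 \<gamma>" using u by (intro wL1_add) auto
    have "((\<lambda>t. ennreal (t powr ((real DIM(real ^ 'n) + 2 * \<gamma>) / (2 * \<sigma>))) * ?A u0 u1 t) \<longlongrightarrow> 0) at_top"
      using u by (intro heat_weighted_tendsto[where B = "K * wL1_norm \<gamma> (?v u0 u1)"] res residual_tendsto[OF assms wv] assms(1,2)) auto
    moreover have "(real DIM(real ^ 'n) + 2 * \<gamma>) / (2 * \<sigma>) = q" by (simp add: q_def)
    ultimately have A: "((\<lambda>t. ennreal (t powr q) * ?A u0 u1 t) \<longlongrightarrow> 0) at_top" by (simp only:)
    have "((\<lambda>t. P * ?l * (t powr q * exp (- t))) \<longlongrightarrow> P * ?l * 0) at_top"
      by (intro tendsto_intros powr_exp_tendsto_0 q)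
    from tendsto_ennrealI[OF this]
    have "((\<lambda>t. ennreal (P * ?l * (t powr q * exp (- t)))) \<longlongrightarrow> 0) at_top"
      by (simp only: mult_zero_right ennreal_0)
    \<comment> \<open>Both halves of the error estimate, multiplied by t^q, vanish: the residual
      part by its little-o at 0, the rest by exponential decay.\<close>
    with A have lim: "((\<lambda>t. 2 * (ennreal (t powr q) * ?A u0 u1 t) + ennreal (P * ?l * (t powr q * exp (- t)))) \<longlongrightarrow> 2 * 0 + 0) at_top"
      by (intro tendsto_add ennreal_tendsto_cmult) auto
    have "((\<lambda>t. ennreal (t powr q * (?e t)\<^sup>2)) \<longlongrightarrow> 0) at_top"
    proof (rule tendsto_sandwich[OF _ _ tendsto_const])
      show "\<forall>\<^sub>F t in at_top. ennreal (t powr q * (?e t)\<^sup>2) \<le>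
          2 * (ennreal (t powr q) * ?A u0 u1 t) + ennreal (P * ?l * (t powr q * exp (- t)))"
        using eventually_ge_at_top[of 1]
      proof eventually_elim
        case (elim t)
        have "ennreal (t powr q * (?e t)\<^sup>2) = ennreal (t powr q) * ennreal ((?e t)\<^sup>2)"
          by (simp add: ennreal_mult')
        also have "\<dots> \<le> ennreal (t powr q) * (2 * ?A u0 u1 t + ennreal (P * exp (- t) * ?l))"
          unfolding ennreal_L2_norm_power2[OF L2[OF u elim]] using elim by (intro mult_left_mono E[OF u]) auto
        also have "\<dots> = 2 * (ennreal (t powr q) * ?A u0 u1 t) + ennreal (t powr q) * ennreal (P * exp (- t) * ?l)"
          by (simp add: distrib_left mult_ac)
        also have "ennreal (t powr q) * ennreal (P * exp (- t) * ?l) = ennreal (P * ?l * (t powr q * exp (- t)))"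
          by (subst ennreal_mult'[symmetric]) (simp_all add: mult_ac)
        finally show ?case .
      qed
      show "((\<lambda>t. 2 * (ennreal (t powr q) * ?A u0 u1 t) + ennreal (P * ?l * (t powr q * exp (- t)))) \<longlongrightarrow> 0) at_top"
        using lim by simp
    qed auto
    then have "((\<lambda>t. t powr q * (?e t)\<^sup>2) \<longlongrightarrow> 0) at_top"
      unfolding ennreal_0[symmetric] by (rule tendsto_ennrealD) auto
    from tendsto_real_sqrt[OF this] have "((\<lambda>t. sqrt (t powr q * (?e t)\<^sup>2)) \<longlongrightarrow> 0) at_top" by simp
    moreover have "sqrt (t powr q * (?e t)\<^sup>2) = t powr (q / 2) * ?e t" for t
    proof -
      have "t powr q = (t powr (q / 2))\<^sup>2" by (simp add: power2_eq_square flip: powr_add)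
      moreover have "?e t \<ge> 0" by (auto simp: L2_norm_def intro!: integral_nonneg_AE)
      ultimately show ?thesis by (simp add: real_sqrt_mult)
    qed
    ultimately show "((\<lambda>t. t powr (real CARD('n) / (4 * \<sigma>) + \<gamma> / (2 * \<sigma>)) * ?e t) \<longlongrightarrow> 0) at_top"
      unfolding q2 by simp
  qed
qed

end
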